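(* Let $\mathbb{K}$ be a field, $S=\mathbb{K}[x_1,\ldots,x_n]$, and let $m=x_{i_1}x_{i_2}\cdots x_{i_s}\in S$ be a square-free monomial with $i_1<i_2<\cdots<i_s\le n$ and $2\leq i_1\leq s-1$. Let $I=\mathrm{sfBorel}(m)$. Suppose $i_j-i_1\geq (j-1)(i_2-i_1)$ for all $3\leq j\leq i_1+1$. Then $$\widehat{\alpha}(I)\leq 2+\frac{s-i_1-1}{i_1(i_2-i_1)}.$$ In addition, if $i_{i_1+1}\geq s-1$ and $i_1(i_2-i_1)=i_{i_1+1}-i_1$, then equality holds. (Here $i_{i_1+1}$ denotes $i_j$ with $j=i_1+1$.)
   Context: Square-free principal Borel ideal. For a monomial $m$, a Borel move of $m$ is a monomial $m\cdot\frac{x_{a_1}}{x_{b_1}}\cdots\frac{x_{a_q}}{x_{b_q}}$ with $a_p<b_p$ and $x_{b_p}\mid m$ for all $p$ (the trivial move giving $m$ itself is allowed). For a square-free monomial $m$, $\mathrm{sfBorel}(m)$ is the ideal of $S$ generated by all square-free monomials that are Borel moves of $m$; equivalently, for $m=x_{i_1}\cdots x_{i_s}$ with $i_1<\cdots<i_s$, it is generated by all $x_{j_1}\cdots x_{j_s}$ with $j_1<\cdots<j_s$ and $j_p\le i_p$ for all $p$. Waldschmidt constant. For a square-free monomial ideal $L\subseteq S$ with minimal primary decomposition $L=P_1\cap\cdots\cap P_t$ (the $P_i$ prime), the $q$-th symbolic power is $L^{(q)}=P_1^q\cap\cdots\cap P_t^q$. Write $\alpha(J)$ for the smallest degree of a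 generator of a homogeneous ideal $J$. Then $\widehat{\alpha}(L)=\lim_{q\to\infty}\alpha(L^{(q)})/q$. *)

theory Defs
  imports Complex_Main "HOL-Library.Poly_Mapping" "HOL-Algebra.Ideal_Product"
begin

section \<open>The polynomial ring\<close>

text \<open>A monomial is its exponent vector, so monomials multiply by adding these, and
  \<open>single b 1\<close> is the variable \<open>x\<^sub>b\<close>. A polynomial maps monomials to coefficients.\<close>

type_synonym monomial = "nat \<Rightarrow>\<^sub>0 nat"
type_synonym 'k mpolynomial = "monomial \<Rightarrow>\<^sub>0 'k"

definition monomials :: "nat \<Rightarrow> monomial set" where
  "monomials n = {m. Poly_Mapping.keys m \<subseteq> {1..n}}"

definition monomial_poly :: "monomial \<Rightarrow> 'k::field mpolynomial" where
  "monomial_poly m = Poly_Mapping.single m 1"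

definition poly_ring :: "nat \<Rightarrow> 'k::field mpolynomial ring" where
  "poly_ring n = \<lparr> carrier = {f. Poly_Mapping.keys f \<subseteq> monomials n},
     mult = (*), one = 1, zero = 0, add = (+) \<rparr>"

lemma cring_poly_ring: "cring (poly_ring n :: 'k::field mpolynomial ring)"
proof -
  let ?C = "{f :: 'k mpolynomial. Poly_Mapping.keys f \<subseteq> monomials n}"
  have add_mon: "a + b \<in> monomials n" if "a \<in> monomials n" "b \<in> monomials n" for a b
    using that Poly_Mapping.keys_add[of a b] unfolding monomials_def by blast
  have add: "f + g \<in> ?C" if "f \<in> ?C" "g \<in> ?C" for f g
    using that Poly_Mapping.keys_add[of f g] by blast
  have mult: "f * g \<in> ?C" if "f \<in> ?C" "g \<in> ?C" for f g
    using that keys_mult[of f g] add_mon by fast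
  have one: "1 \<in> ?C" by (simp add: monomials_def)
  have neg: "- f \<in> ?C" if "f \<in> ?C" for f
    using that by (simp add: keys_minus)
  show ?thesis
  proof (rule cringI)
    show "abelian_group (poly_ring n :: 'k mpolynomial ring)"
    proof (rule abelian_groupI)
      fix f :: "'k mpolynomial" assume "f \<in> carrier (poly_ring n)"
      then have "- f \<in> carrier (poly_ring n)" "- f \<oplus>\<^bsub>poly_ring n\<^esub> f = \<zero>\<^bsub>poly_ring n\<^esub>"
        using neg by (simp_all add: poly_ring_def)
      then show "\<exists>g\<in>carrier (poly_ring n). g \<oplus>\<^bsub>poly_ring n\<^esub> f = \<zero>\<^bsub>poly_ring n\<^esub>"
        by blast
    qed (use add in \<open>auto simp: poly_ring_def ac_simps\<close>)
    show "Group.comm_monoid (poly_ring n :: 'k mpolynomial ring)"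
      by (rule comm_monoidI) (use mult one in \<open>auto simp: poly_ring_def ac_simps\<close>)
  qed (auto simp: poly_ring_def distrib_right)
qed

section \<open>Square-free principal Borel ideals\<close>

definition squarefree_monomial :: "monomial \<Rightarrow> bool" where
  "squarefree_monomial m \<longleftrightarrow> (\<forall>k. Poly_Mapping.lookup m k \<le> 1)"

text \<open>The list \<open>ps\<close> holds the pairs \<open>(a\<^sub>p, b\<^sub>p)\<close>; the identity
  \<open>m' = m \<cdot> \<Prod>\<^sub>p x\<^bsub>a\<^sub>p\<^esub> / x\<^bsub>b\<^sub>p\<^esub>\<close> is stated with denominators cleared.\<close>

definition borel_move :: "monomial \<Rightarrow> monomial \<Rightarrow> bool" where
  "borel_move m m' \<longleftrightarrow> (\<exists>ps :: (nat \<times> nat) list.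
     (\<forall>(a, b) \<in> set ps. 1 \<le> a \<and> a < b \<and> b \<in> Poly_Mapping.keys m) \<and>
     m' + (\<Sum>(a, b)\<leftarrow>ps. Poly_Mapping.single b 1) =
     m + (\<Sum>(a, b)\<leftarrow>ps. Poly_Mapping.single a 1))"

definition sfBorel :: "nat \<Rightarrow> monomial \<Rightarrow> 'k::field mpolynomial set" where
  "sfBorel n m =
     Idl\<^bsub>poly_ring n\<^esub> (monomial_poly ` {m'. squarefree_monomial m' \<and> borel_move m m'})"

section \<open>Symbolic powers\<close>

definition minimal_prime_decomposition ::
    "('a, 'b) ring_scheme \<Rightarrow> 'a set \<Rightarrow> 'a set set \<Rightarrow> bool" where
  "minimal_prime_decomposition R L Ps \<longleftrightarrow>
     finite Ps \<and> (\<forall>P\<in>Ps. primeideal P R) \<and> carrier R \<inter> \<Inter>Ps = L \<and>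
     (\<forall>Qs. Qs \<subset> Ps \<longrightarrow> carrier R \<inter> \<Inter>Qs \<noteq> L)"

lemma primeideal_finite_Inter_subset:
  assumes "primeideal P R" "finite Qs" "\<forall>Q\<in>Qs. ideal Q R" "carrier R \<inter> \<Inter>Qs \<subseteq> P"
  shows "\<exists>Q\<in>Qs. Q \<subseteq> P"
  using assms(2,3,4)
proof (induction Qs rule: finite_induct)
  case empty
  interpret primeideal P R by fact
  show ?case using empty I_notcarr a_subset by auto
next
  case (insert Q Qs)
  interpret primeideal P R by fact
  show ?case
  proof (cases "Q \<subseteq> P")
    case False
    then obtain x where x: "x \<in> Q" "x \<notin> P" by blast
    have Q: "ideal Q R" using insert.prems by simp
    have xc: "x \<in> carrier R" using x(1) Q by (rule_tac ideal.Icarr)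
    have "carrier R \<inter> \<Inter>Qs \<subseteq> P"
    proof
      fix y assume y: "y \<in> carrier R \<inter> \<Inter>Qs"
      have "x \<otimes>\<^bsub>R\<^esub> y \<in> Q" using Q x(1) y by (simp add: ideal.I_r_closed)
      moreover have "x \<otimes>\<^bsub>R\<^esub> y \<in> Z" if "Z \<in> Qs" for Z
        using that insert.prems(1) y xc by (simp add: ideal.I_l_closed)
      ultimately have "x \<otimes>\<^bsub>R\<^esub> y \<in> P" using insert.prems(2) xc y by blast
      then show "y \<in> P" using I_prime[of x y] x(2) xc y by blast
    qed
    then show ?thesis using insert by auto
  qed auto
qed

lemma minimal_prime_decomposition_subset:
  assumes "minimal_prime_decomposition R L Ps" "minimal_prime_decomposition R L Qs"
  shows "Ps \<subseteq> Qs"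
proof
  fix P assume P: "P \<in> Ps"
  have prime: "primeideal X R" if "X \<in> Ps \<union> Qs" for X
    using that assms unfolding minimal_prime_decomposition_def by blast
  have ideals: "\<forall>X\<in>Qs. ideal X R" "\<forall>X\<in>Ps. ideal X R"
    using prime by (auto intro: primeideal.axioms(1))
  have fin: "finite Ps" "finite Qs" and eq: "carrier R \<inter> \<Inter>Ps = L" "carrier R \<inter> \<Inter>Qs = L"
    using assms unfolding minimal_prime_decomposition_def by blast+
  have irred: "\<And>Zs. Zs \<subset> Ps \<Longrightarrow> carrier R \<inter> \<Inter>Zs \<noteq> L"
    using assms(1) unfolding minimal_prime_decomposition_def by blast
  obtain Q where Q: "Q \<in> Qs" "Q \<subseteq> P"
    using primeideal_finite_Inter_subset[of P R Qs] prime P fin ideals eq by blast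
  obtain P' where P': "P' \<in> Ps" "P' \<subseteq> Q"
    using primeideal_finite_Inter_subset[of Q R Ps] prime Q fin ideals eq by blast
  have "P' = P"
  proof (rule ccontr)
    assume "P' \<noteq> P"
    then have "\<Inter>(Ps - {P}) = \<Inter>Ps" using P P' Q by blast
    then show False using irred[of "Ps - {P}"] P eq by auto
  qed
  then show "P \<in> Qs" using P' Q by auto
qed

text \<open>Hence the definite description in the definition of symbolic powers is unambiguous.\<close>

lemma minimal_prime_decomposition_unique:
  assumes "minimal_prime_decomposition R L Ps" "minimal_prime_decomposition R L Qs"
  shows "Ps = Qs"
  using assms by (intro subset_antisym minimal_prime_decomposition_subset)

definition symbolic_power :: "('a, 'b) ring_scheme \<Rightarrow> 'a set \<Rightarrow> nat \<Rightarrow> 'a set" where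
  "symbolic_power R L q =
     carrier R \<inter> (\<Inter>P \<in> (THE Ps. minimal_prime_decomposition R L Ps). P [^]\<^bsub>ideals_set R\<^esub> q)"

section \<open>The Waldschmidt constant\<close>

definition mdegree :: "monomial \<Rightarrow> nat" where
  "mdegree m = (\<Sum>k\<in>Poly_Mapping.keys m. Poly_Mapping.lookup m k)"

definition homogeneous :: "nat \<Rightarrow> 'k::field mpolynomial \<Rightarrow> bool" where
  "homogeneous d f \<longleftrightarrow> (\<forall>m\<in>Poly_Mapping.keys f. mdegree m = d)"

text \<open>\<open>G\<close> ranges over all generating sets of \<open>J\<close> by nonzero homogeneous elements.\<close>

definition alpha :: "nat \<Rightarrow> 'k::field mpolynomial set \<Rightarrow> nat" where
  "alpha n J = (LEAST d. \<exists>G. G \<subseteq> carrier (poly_ring n) \<and>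
     (\<forall>g\<in>G. g \<noteq> 0 \<and> (\<exists>e. homogeneous e g)) \<and>
     Idl\<^bsub>poly_ring n\<^esub> G = J \<and> (\<exists>g\<in>G. homogeneous d g))"

definition waldschmidt :: "nat \<Rightarrow> 'k::field mpolynomial set \<Rightarrow> real" where
  "waldschmidt n L = lim (\<lambda>q. real (alpha n (symbolic_power (poly_ring n) L q)) / real q)"

end

theory Submission
  imports Defs
begin

text \<open>
  For any ideal generated by square-free monomials, the Waldschmidt constant is the value of a linear
  program. The minimal primes are generated by the variables of the minimal sets \<open>C\<close> that meet the
  support of every generator (\<open>minimal_prime_decomposition_squarefree\<close>), and a power \<open>P\<^sup>q\<close> of such a
  prime is spanned by the monomials with exponent sum at least \<open>q\<close> on \<open>C\<close>
  (\<open>cover_prime_power\<close>). So \<open>\<alpha>(I\<^bsup>(q)\<^esup>)\<close> is the least degree of an exponent vector with sum at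
  least \<open>q\<close> on every cover, and in the limit \<open>q \<rightarrow> \<infinity>\<close> the rescaled exponents become arbitrary
  nonnegative real weights: the constant is the infimum of the total weight over all weightings that give
  every cover weight at least 1 (\<open>waldschmidt_squarefree\<close>).

  For \<open>I = sfBorel(m)\<close> with \<open>m = x\<^bsub>i 1\<^esub> \<cdots> x\<^bsub>i s\<^esub>\<close> the covers are easy to describe: \<open>C\<close> is one iff for some \<open>p\<close>
  fewer than \<open>p\<close> elements of \<open>{1..i p}\<close> lie outside \<open>C\<close> (\<open>cover_borel_iff\<close>).

  Put \<open>a = i 1\<close> and \<open>d = i 2 - i 1\<close>. The upper bound is the total weight of the feasible weighting
  that is \<open>1 / a\<close> on the first \<open>a\<close> variables and \<open>1 / (a d)\<close> on the following \<open>a d + s - 1 - a\<close>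
  (\<open>borel_cover_weighting\<close>). Under the additional hypotheses the constraints for \<open>p = 1\<close>, \<open>p = a + 1\<close> and
  \<open>p = s\<close> alone force every feasible weighting to be at least as heavy
  (\<open>borel_cover_weighting_lower\<close>).
\<close>

section \<open>Symbolic powers of square-free monomial ideals\<close>

text \<open>For a set \<open>U\<close> closed under multiples this is the monomial ideal whose monomials are those
  of \<open>U\<close>. All ideals below (generated ideals, primes, their powers, symbolic powers) have this form,
  so that every ideal-theoretic question becomes one about sets of exponent vectors.\<close>

definition monomial_span :: "monomial set \<Rightarrow> 'k::field mpolynomial set" where
  "monomial_span U = {f. Poly_Mapping.keys f \<subseteq> U}"

definition multiple_closed :: "nat \<Rightarrow> monomial set \<Rightarrow> bool" where
  "multiple_closed n U \<longleftrightarrow> U \<subseteq> monomials n \<and> (\<forall>u\<in>U. \<forall>v\<in>monomials n. u + v \<in> U)"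

definition multiples :: "nat \<Rightarrow> monomial set \<Rightarrow> monomial set" where
  "multiples n G = {g + v |g v. g \<in> G \<and> v \<in> monomials n}"

lemma monomials_add: "a \<in> monomials n \<Longrightarrow> b \<in> monomials n \<Longrightarrow> a + b \<in> monomials n"
  using Poly_Mapping.keys_add[of a b] unfolding monomials_def by blast

lemma zero_in_monomials [simp]: "0 \<in> monomials n"
  by (simp add: monomials_def)

lemma carrier_poly_ring: "carrier (poly_ring n) = monomial_span (monomials n)"
  by (simp add: poly_ring_def monomial_span_def)

lemma multiple_closed_multiples:
  assumes "G \<subseteq> monomials n"
  shows "multiple_closed n (multiples n G)"
  unfolding multiple_closed_def
proof (intro conjI ballI)
  show "multiples n G \<subseteq> monomials n"
    using assms monomials_add by (auto simp: multiples_def)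
  fix u v assume "u \<in> multiples n G" and v: "v \<in> monomials n"
  then obtain g w where "u = g + w" "g \<in> G" "w \<in> monomials n"
    by (auto simp: multiples_def)
  then show "u + v \<in> multiples n G"
    using v monomials_add[of w n v] by (auto simp: multiples_def add.assoc)
qed

lemma monomial_poly_in_span [simp]: "monomial_poly u \<in> monomial_span U \<longleftrightarrow> u \<in> U"
  by (simp add: monomial_span_def monomial_poly_def)

lemma monomial_poly_add: "monomial_poly (u + v) = monomial_poly u * monomial_poly v"
  by (simp add: monomial_poly_def mult_single)

lemma monomial_span_ideal:
  assumes "multiple_closed n U"
  shows "ideal (monomial_span U :: 'k::field mpolynomial set) (poly_ring n)"
proof -
  interpret cring "poly_ring n :: 'k mpolynomial ring" by (rule cring_poly_ring)
  have U: "U \<subseteq> monomials n" using assms by (simp add: multiple_closed_def)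
  have l: "x * a \<in> monomial_span U"
    if "a \<in> monomial_span U" "x \<in> monomial_span (monomials n)" for a x :: "'k mpolynomial"
  proof -
    have "u + v \<in> U" if "u \<in> Poly_Mapping.keys x" "v \<in> Poly_Mapping.keys a" for u v
      using assms that \<open>a \<in> _\<close> \<open>x \<in> _\<close>
      by (subst add.commute) (auto simp: multiple_closed_def monomial_span_def subset_iff)
    then show ?thesis using keys_mult[of x a] unfolding monomial_span_def by blast
  qed
  show ?thesis
  proof (rule idealI)
    show "ring (poly_ring n :: 'k mpolynomial ring)" by (rule ring_axioms)
    show "subgroup (monomial_span U) (add_monoid (poly_ring n :: 'k mpolynomial ring))"
    proof (rule add.subgroupI)
      show "monomial_span U \<subseteq> carrier (poly_ring n :: 'k mpolynomial ring)"
        using U by (auto simp: carrier_poly_ring monomial_span_def)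
      show "(monomial_span U :: 'k mpolynomial set) \<noteq> {}"
        by (auto simp: monomial_span_def intro: exI[of _ 0])
      fix a :: "'k mpolynomial" assume a: "a \<in> monomial_span U"
      have "\<ominus>\<^bsub>poly_ring n\<^esub> a = - a"
        by (rule minus_equality)
          (use a U in \<open>auto simp: poly_ring_def monomial_span_def\<close>)
      then show "\<ominus>\<^bsub>poly_ring n\<^esub> a \<in> monomial_span U"
        using a by (simp add: monomial_span_def)
    next
      fix a b :: "'k mpolynomial"
      assume "a \<in> monomial_span U" "b \<in> monomial_span U"
      then show "a \<oplus>\<^bsub>poly_ring n\<^esub> b \<in> monomial_span U"
        using Poly_Mapping.keys_add[of a b] by (auto simp: monomial_span_def poly_ring_def)
    qed
  qed (use l in \<open>auto simp: poly_ring_def monomial_span_def mult.commute\<close>)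
qed

text \<open>A polynomial is a finite sum of constants times monomials, so an ideal contains it as soon as it
  contains its monomials; the induction splits off one term at a time.\<close>

lemma ideal_contains_monomial_span:
  fixes K :: "'k::field mpolynomial set"
  assumes K: "ideal K (poly_ring n)" and U: "U \<subseteq> monomials n"
    and mon: "\<And>u. u \<in> U \<Longrightarrow> monomial_poly u \<in> K"
  shows "monomial_span U \<subseteq> K"
proof
  interpret ideal K "poly_ring n" by fact
  fix f :: "'k mpolynomial" assume "f \<in> monomial_span U"
  then show "f \<in> K"
  proof (induction "Poly_Mapping.keys f" arbitrary: f rule: infinite_finite_induct)
    case empty
    then have "f = \<zero>\<^bsub>poly_ring n\<^esub>" by (metis keys_eq_empty poly_ring_def ring.select_convs(1))
    then show ?case by simp
  next
    case (insert u A)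
    define h where "h = Poly_Mapping.single u (Poly_Mapping.lookup f u)"
    have lk: "Poly_Mapping.lookup (f - h) v = (if v = u then 0 else Poly_Mapping.lookup f v)" for v
      by (simp add: h_def lookup_minus lookup_single)
    have "Poly_Mapping.keys (f - h) = A"
      using insert.hyps(2,4) by (auto simp: in_keys_iff lk split: if_splits)
    then have fh: "f - h \<in> K"
      using insert.hyps insert.prems by (intro insert.hyps(3)) (auto simp: monomial_span_def)
    have u: "u \<in> U" using insert.hyps(4) insert.prems by (auto simp: monomial_span_def)
    have "Poly_Mapping.single 0 (Poly_Mapping.lookup f u) \<otimes>\<^bsub>poly_ring n\<^esub> monomial_poly u \<in> K"
      by (rule I_l_closed[OF mon[OF u]]) (simp add: carrier_poly_ring monomial_span_def)
    then have "h \<in> K" by (simp add: h_def poly_ring_def monomial_poly_def mult_single)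
    then have "(f - h) \<oplus>\<^bsub>poly_ring n\<^esub> h \<in> K" using fh
      by (intro additive_subgroup.a_closed[OF is_additive_subgroup])
    then show ?case by (simp add: poly_ring_def)
  qed simp
qed

lemma Idl_monomials:
  assumes "G \<subseteq> monomials n"
  shows "Idl\<^bsub>poly_ring n\<^esub> (monomial_poly ` G) =
    (monomial_span (multiples n G) :: 'k::field mpolynomial set)"
proof -
  interpret cring "poly_ring n :: 'k mpolynomial ring" by (rule cring_poly_ring)
  let ?H = "monomial_poly ` G :: 'k mpolynomial set"
  have H: "?H \<subseteq> carrier (poly_ring n)" using assms by (auto simp: carrier_poly_ring)
  have self: "g \<in> multiples n G" if "g \<in> G" for g
    using that by (force simp: multiples_def intro: exI[of _ 0])
  interpret I: ideal "Idl\<^bsub>poly_ring n\<^esub> ?H" "poly_ring n" by (rule genideal_ideal[OF H])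
  show ?thesis
  proof
    show "Idl\<^bsub>poly_ring n\<^esub> ?H \<subseteq> monomial_span (multiples n G)"
      using self by (intro genideal_minimal monomial_span_ideal multiple_closed_multiples assms) auto
    show "monomial_span (multiples n G) \<subseteq> Idl\<^bsub>poly_ring n\<^esub> ?H"
    proof (rule ideal_contains_monomial_span[OF I.ideal_axioms])
      show "multiples n G \<subseteq> monomials n"
        using multiple_closed_multiples[OF assms] by (simp add: multiple_closed_def)
      fix u assume "u \<in> multiples n G"
      then obtain g v where u: "u = g + v" and g: "g \<in> G" and v: "v \<in> monomials n"
        by (auto simp: multiples_def)
      have "(monomial_poly g :: 'k mpolynomial) \<in> Idl\<^bsub>poly_ring n\<^esub> ?H"
        using genideal_self[OF H] g by blast
      then have "(monomial_poly g :: 'k mpolynomial) \<otimes>\<^bsub>poly_ring n\<^esub> monomial_poly v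
          \<in> Idl\<^bsub>poly_ring n\<^esub> ?H"
        using v by (intro I.I_r_closed) (auto simp: carrier_poly_ring)
      then show "(monomial_poly u :: 'k mpolynomial) \<in> Idl\<^bsub>poly_ring n\<^esub> ?H"
        by (simp add: u monomial_poly_add poly_ring_def)
    qed
  qed
qed

text \<open>A homogeneous generator of degree \<open>d\<close> is a nonzero element of the ideal, so any monomial in it
  lies in \<open>U\<close> and has degree \<open>d\<close>. Conversely all of \<open>U\<close> may serve as the generating set, and so every
  degree occurring in \<open>U\<close> is attained by some generating set. The least element is then the
  same on both sides.\<close>

lemma alpha_monomial_span:
  assumes U: "multiple_closed n U"
  shows "alpha n (monomial_span U :: 'k::field mpolynomial set) = (LEAST d. d \<in> mdegree ` U)"
proof -
  interpret cring "poly_ring n :: 'k mpolynomial ring" by (rule cring_poly_ring)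
  have Um: "U \<subseteq> monomials n" using U by (simp add: multiple_closed_def)
  let ?P = "\<lambda>d. \<exists>G. G \<subseteq> carrier (poly_ring n) \<and>
     (\<forall>g\<in>G. g \<noteq> 0 \<and> (\<exists>e. homogeneous e g)) \<and>
     Idl\<^bsub>poly_ring n\<^esub> G = (monomial_span U :: 'k mpolynomial set) \<and> (\<exists>g\<in>G. homogeneous d g)"
  have "?P d \<longleftrightarrow> d \<in> mdegree ` U" for d
  proof
    assume "?P d"
    then obtain G and g :: "'k mpolynomial" where G: "G \<subseteq> carrier (poly_ring n)" "g \<in> G" "g \<noteq> 0"
      "Idl\<^bsub>poly_ring n\<^esub> G = monomial_span U" "homogeneous d g" by blast
    then have "g \<in> monomial_span U" using genideal_self[of G] by blast
    moreover obtain u where "u \<in> Poly_Mapping.keys g" using \<open>g \<noteq> 0\<close> by (metis all_not_in_conv keys_eq_empty)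
    ultimately show "d \<in> mdegree ` U"
      using G(5) by (auto simp: monomial_span_def homogeneous_def)
  next
    assume "d \<in> mdegree ` U"
    then obtain u where u: "u \<in> U" "d = mdegree u" by blast
    have "multiples n U = U"
    proof
      show "multiples n U \<subseteq> U" using U by (auto simp: multiples_def multiple_closed_def)
      show "U \<subseteq> multiples n U" by (force simp: multiples_def intro: exI[of _ 0])
    qed
    then have "Idl\<^bsub>poly_ring n\<^esub> (monomial_poly ` U) = (monomial_span U :: 'k mpolynomial set)"
      using Idl_monomials[OF Um] by metis
    moreover have "homogeneous (mdegree v) (monomial_poly v :: 'k mpolynomial)"
        "(monomial_poly v :: 'k mpolynomial) \<noteq> 0" for v
      by (auto simp: homogeneous_def monomial_poly_def simp flip: keys_eq_empty)
    ultimately show "?P d"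
      using u Um by (intro exI[of _ "monomial_poly ` U"]) (auto simp: carrier_poly_ring)
  qed
  then show ?thesis by (simp add: alpha_def)
qed

text \<open>The monomials of the \<open>q\<close>-th power of the prime ideal generated by the variables \<open>x\<^sub>k\<close>,
  \<open>k \<in> C\<close>; for \<open>q = 1\<close>, those of the prime itself.\<close>

definition heavy_monomials :: "nat \<Rightarrow> nat set \<Rightarrow> nat \<Rightarrow> monomial set" where
  "heavy_monomials n C q = {u \<in> monomials n. q \<le> (\<Sum>k\<in>C. Poly_Mapping.lookup u k)}"

lemma multiple_closed_heavy: "multiple_closed n (heavy_monomials n C q)"
  by (auto simp: multiple_closed_def heavy_monomials_def monomials_add lookup_add sum.distrib)

lemma heavy_monomials_one:
  assumes "finite C"
  shows "u \<in> heavy_monomials n C 1 \<longleftrightarrow> u \<in> monomials n \<and> C \<inter> Poly_Mapping.keys u \<noteq> {}"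
proof -
  have "1 \<le> (\<Sum>k\<in>C. Poly_Mapping.lookup u k) \<longleftrightarrow> (\<Sum>k\<in>C. Poly_Mapping.lookup u k) \<noteq> 0" by auto
  also have "\<dots> \<longleftrightarrow> C \<inter> Poly_Mapping.keys u \<noteq> {}"
    using assms by (subst sum_eq_0_iff) (auto simp: in_keys_iff)
  finally show ?thesis by (simp add: heavy_monomials_def)
qed

lemma restrict_decomposition:
  fixes f :: "'k::field mpolynomial"
  obtains f0 f1 where "f = f0 + f1" "Poly_Mapping.keys f0 = Poly_Mapping.keys f - U"
    "Poly_Mapping.keys f1 = Poly_Mapping.keys f \<inter> U"
proof -
  define r where "r V = Abs_poly_mapping (\<lambda>u. Poly_Mapping.lookup f u when u \<in> V)" for V
  have lk: "Poly_Mapping.lookup (r V) = (\<lambda>u. Poly_Mapping.lookup f u when u \<in> V)" for V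
  proof -
    have "finite {u. (Poly_Mapping.lookup f u when u \<in> V) \<noteq> 0}"
      by (rule finite_subset[OF _ finite_keys[of f]]) (auto simp: in_keys_iff)
    then show ?thesis unfolding r_def by (simp add: lookup_Abs_poly_mapping)
  qed
  show ?thesis
    by (rule that[of "r (- U)" "r U"])
      (auto intro!: poly_mapping_eqI simp: lookup_add lk in_keys_iff when_def split: if_splits)
qed

text \<open>Modulo this ideal, a polynomial may be replaced by the sum of its terms that avoid the variables
  of \<open>C\<close>. The product of two such sums again avoids them, so it lies in the ideal only if it
  vanishes; as polynomials over a field form an integral domain, one of the factors vanishes.\<close>

lemma primeideal_cover:
  assumes C: "C \<subseteq> {1..n}"
  shows "primeideal (monomial_span (heavy_monomials n C 1) :: 'k::field mpolynomial set) (poly_ring n)"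
proof (rule primeidealI)
  let ?U = "heavy_monomials n C 1"
  have fin: "finite C" using C finite_subset by blast
  note U = heavy_monomials_one[OF fin]
  show id: "ideal (monomial_span ?U :: 'k mpolynomial set) (poly_ring n)"
    by (intro monomial_span_ideal multiple_closed_heavy)
  show "cring (poly_ring n :: 'k mpolynomial ring)" by (rule cring_poly_ring)
  have "(monomial_poly 0 :: 'k mpolynomial) \<in> carrier (poly_ring n) - monomial_span ?U"
    using U[of 0] by (simp add: carrier_poly_ring)
  then show "carrier (poly_ring n) \<noteq> (monomial_span ?U :: 'k mpolynomial set)" by blast
  fix f g :: "'k mpolynomial"
  assume f: "f \<in> carrier (poly_ring n)" and g: "g \<in> carrier (poly_ring n)"
    and fg: "f \<otimes>\<^bsub>poly_ring n\<^esub> g \<in> monomial_span ?U"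
  interpret ideal "monomial_span ?U :: 'k mpolynomial set" "poly_ring n" by (rule id)
  obtain f0 f1 where f01: "f = f0 + f1" "Poly_Mapping.keys f0 = Poly_Mapping.keys f - ?U"
    "Poly_Mapping.keys f1 = Poly_Mapping.keys f \<inter> ?U" by (rule restrict_decomposition)
  obtain g0 g1 where g01: "g = g0 + g1" "Poly_Mapping.keys g0 = Poly_Mapping.keys g - ?U"
    "Poly_Mapping.keys g1 = Poly_Mapping.keys g \<inter> ?U" by (rule restrict_decomposition)
  have ring_simps: "x \<otimes>\<^bsub>poly_ring n\<^esub> y = x * y" "x \<oplus>\<^bsub>poly_ring n\<^esub> y = x + y"
    for x y :: "'k mpolynomial"
    by (simp_all add: poly_ring_def)
  have carr: "f0 \<in> carrier (poly_ring n)" "g \<in> carrier (poly_ring n)"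
    using f g f01(2) by (auto simp: carrier_poly_ring monomial_span_def)
  have f1: "f1 \<in> monomial_span ?U" and g1: "g1 \<in> monomial_span ?U"
    using f01(3) g01(3) by (auto simp: monomial_span_def)
  have "f1 * g \<in> monomial_span ?U" "f0 * g1 \<in> monomial_span ?U"
    using I_r_closed[of f1 g] I_l_closed[of g1 f0] f1 g1 carr by (simp_all add: ring_simps)
  then have "f1 * g + f0 * g1 \<in> monomial_span ?U"
    using additive_subgroup.a_closed[OF is_additive_subgroup, of "f1 * g" "f0 * g1"]
    unfolding ring_simps by blast
  moreover have "f0 * g0 = f * g - (f1 * g + f0 * g1)"
    using f01(1) g01(1) by (simp add: algebra_simps)
  ultimately have in_U: "Poly_Mapping.keys (f0 * g0) \<subseteq> ?U"
    using fg keys_diff[of "f * g" "f1 * g + f0 * g1"]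
    by (auto simp: monomial_span_def ring_simps)
  have "u + v \<notin> ?U" if "u \<in> Poly_Mapping.keys f0" "v \<in> Poly_Mapping.keys g0" for u v
  proof -
    have "u \<in> monomials n" "v \<in> monomials n"
      using that f01(2) g01(2) f g by (auto simp: carrier_poly_ring monomial_span_def)
    then have "C \<inter> Poly_Mapping.keys u = {}" "C \<inter> Poly_Mapping.keys v = {}"
      using that f01(2) g01(2) U by blast+
    then show ?thesis using U[of "u + v"] Poly_Mapping.keys_add[of u v] by blast
  qed
  then have "Poly_Mapping.keys (f0 * g0) \<inter> ?U = {}" using keys_mult[of f0 g0] by blast
  then have "Poly_Mapping.keys (f0 * g0) = {}" using in_U by blast
  then have "f0 * g0 = 0" by simp
  then have "f0 = 0 \<or> g0 = 0" by simp
  then show "f \<in> monomial_span ?U \<or> g \<in> monomial_span ?U"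
    using f01(1) g01(1) f1 g1 by auto
qed

text \<open>A monomial with exponent sum at least \<open>q + 1\<close> on \<open>C\<close> is divisible by some \<open>x\<^sub>k\<close> with \<open>k \<in> C\<close>, and
  the quotient still has exponent sum at least \<open>q\<close> there.\<close>

lemma cover_prime_power:
  assumes C: "C \<subseteq> {1..n}"
  shows "(monomial_span (heavy_monomials n C 1) :: 'k::field mpolynomial set)
      [^]\<^bsub>ideals_set (poly_ring n)\<^esub> q = monomial_span (heavy_monomials n C q)"
proof (induction q)
  case 0
  then show ?case by (simp add: ideals_set_def carrier_poly_ring heavy_monomials_def)
next
  case (Suc q)
  interpret cring "poly_ring n :: 'k mpolynomial ring" by (rule cring_poly_ring)
  have fin: "finite C" using C finite_subset by blast
  let ?M = "\<lambda>q. monomial_span (heavy_monomials n C q) :: 'k mpolynomial set"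
  have id: "ideal (?M q) (poly_ring n)" for q
    by (intro monomial_span_ideal multiple_closed_heavy)
  have "ideal_prod (poly_ring n) (?M q) (?M 1) = ?M (Suc q)"
  proof
    show "ideal_prod (poly_ring n) (?M q) (?M 1) \<subseteq> ?M (Suc q)"
    proof
      fix f assume "f \<in> ideal_prod (poly_ring n) (?M q) (?M 1)"
      then show "f \<in> ?M (Suc q)"
      proof induction
        case (prod f g)
        have "u + v \<in> heavy_monomials n C (Suc q)"
          if "u \<in> Poly_Mapping.keys f" "v \<in> Poly_Mapping.keys g" for u v
        proof -
          have "u \<in> heavy_monomials n C q" "v \<in> heavy_monomials n C 1"
            using that prod by (auto simp: monomial_span_def)
          then show ?thesis
            by (auto simp: heavy_monomials_def monomials_add lookup_add sum.distrib)
        qed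
        then have "Poly_Mapping.keys (f * g) \<subseteq> heavy_monomials n C (Suc q)"
          using keys_mult[of f g] by blast
        then show ?case by (simp add: monomial_span_def poly_ring_def)
      next
        case (sum f g)
        interpret M: ideal "?M (Suc q)" "poly_ring n" by (rule id)
        show ?case using sum by (intro additive_subgroup.a_closed[OF M.is_additive_subgroup])
      qed
    qed
    show "?M (Suc q) \<subseteq> ideal_prod (poly_ring n) (?M q) (?M 1)"
    proof (rule ideal_contains_monomial_span[OF ideal_prod_is_ideal[OF id id]])
      show "heavy_monomials n C (Suc q) \<subseteq> monomials n" by (auto simp: heavy_monomials_def)
      fix u assume u: "u \<in> heavy_monomials n C (Suc q)"
      then have "u \<in> heavy_monomials n C 1" by (auto simp: heavy_monomials_def)
      then obtain k where k: "k \<in> C" "k \<in> Poly_Mapping.keys u"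
        using heavy_monomials_one[OF fin] by blast
      define x where "x = (Poly_Mapping.single k 1 :: monomial)"
      have x: "Poly_Mapping.lookup x j = (if j = k then 1 else 0)" for j
        by (simp add: x_def lookup_single when_def)
      have lk: "Poly_Mapping.lookup (u - x) j = Poly_Mapping.lookup u j - (if j = k then 1 else 0)" for j
        by (simp add: x lookup_minus)
      have ux: "u = (u - x) + x"
        using k by (intro poly_mapping_eqI) (auto simp: lookup_add lk x in_keys_iff)
      have xh: "x \<in> heavy_monomials n C 1"
        unfolding heavy_monomials_one[OF fin] using k C by (auto simp: x_def monomials_def)
      have "Poly_Mapping.keys (u - x) \<subseteq> Poly_Mapping.keys u" by (auto simp: in_keys_iff lk)
      then have "u - x \<in> monomials n" using u by (auto simp: heavy_monomials_def monomials_def)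
      moreover have "(\<Sum>j\<in>C. Poly_Mapping.lookup u j)
          = (\<Sum>j\<in>C. Poly_Mapping.lookup (u - x) j) + (\<Sum>j\<in>C. Poly_Mapping.lookup x j)"
        by (subst ux) (simp add: lookup_add sum.distrib)
      moreover have "(\<Sum>j\<in>C. Poly_Mapping.lookup x j) = 1"
        using k fin by (simp add: x)
      ultimately have "u - x \<in> heavy_monomials n C q"
        using u by (simp add: heavy_monomials_def)
      then have "(monomial_poly (u - x) :: 'k mpolynomial) \<otimes>\<^bsub>poly_ring n\<^esub> monomial_poly x
          \<in> ideal_prod (poly_ring n) (?M q) (?M 1)"
        using xh by (intro ideal_prod.prod) auto
      moreover have "(monomial_poly (u - x) :: 'k mpolynomial) \<otimes>\<^bsub>poly_ring n\<^esub> monomial_poly x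
          = monomial_poly u"
        by (subst (2) ux) (simp only: monomial_poly_add, simp add: poly_ring_def)
      ultimately show "(monomial_poly u :: 'k mpolynomial) \<in> ideal_prod (poly_ring n) (?M q) (?M 1)"
        by simp
    qed
  qed
  with Suc show ?case by (simp add: ideals_set_def)
qed

text \<open>Transversals of the supports of the generators, which correspond to the monomial primes
  containing the ideal; the inclusion-minimal ones give the minimal primes.\<close>

definition cover :: "nat \<Rightarrow> monomial set \<Rightarrow> nat set \<Rightarrow> bool" where
  "cover n G C \<longleftrightarrow> C \<subseteq> {1..n} \<and> (\<forall>g\<in>G. C \<inter> Poly_Mapping.keys g \<noteq> {})"

definition minimal_cover :: "nat \<Rightarrow> monomial set \<Rightarrow> nat set \<Rightarrow> bool" where
  "minimal_cover n G C \<longleftrightarrow> cover n G C \<and> (\<forall>D. D \<subset> C \<longrightarrow> \<not> cover n G D)"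

definition variable_product :: "nat set \<Rightarrow> monomial" where
  "variable_product A = (\<Sum>k\<in>A. Poly_Mapping.single k 1)"

lemma lookup_variable_product:
  "finite A \<Longrightarrow> Poly_Mapping.lookup (variable_product A) k = (if k \<in> A then 1 else 0)"
  by (simp add: variable_product_def lookup_sum lookup_single when_def)

lemma keys_variable_product: "finite A \<Longrightarrow> Poly_Mapping.keys (variable_product A) = A"
  by (auto simp: in_keys_iff lookup_variable_product split: if_splits)

lemma cover_mono: "cover n G C \<Longrightarrow> C \<subseteq> D \<Longrightarrow> D \<subseteq> {1..n} \<Longrightarrow> cover n G D"
  unfolding cover_def by (meson disjoint_iff subsetD)

lemma minimal_cover_exists:
  assumes "cover n G C"
  obtains D where "D \<subseteq> C" "minimal_cover n G D"
proof -
  have "finite C" using assms finite_subset unfolding cover_def by blast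
  then have "cover n G C \<longrightarrow> (\<exists>D\<subseteq>C. minimal_cover n G D)"
  proof (induction rule: finite_psubset_induct)
    case (psubset C)
    show ?case
    proof (intro impI, cases "minimal_cover n G C")
      case False
      assume "cover n G C"
      then obtain B where "B \<subset> C" "cover n G B" using False by (auto simp: minimal_cover_def)
      then show "\<exists>D\<subseteq>C. minimal_cover n G D" using psubset.IH[of B] by blast
    qed blast
  qed
  then show ?thesis using assms that by blast
qed

lemma squarefree_multiples_iff:
  assumes "squarefree_monomial g" "u \<in> monomials n"
  shows "(\<exists>v\<in>monomials n. u = g + v) \<longleftrightarrow> Poly_Mapping.keys g \<subseteq> Poly_Mapping.keys u"
proof
  assume "\<exists>v\<in>monomials n. u = g + v"
  then show "Poly_Mapping.keys g \<subseteq> Poly_Mapping.keys u" by (auto simp: in_keys_iff lookup_add)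
next
  assume sub: "Poly_Mapping.keys g \<subseteq> Poly_Mapping.keys u"
  have le: "Poly_Mapping.lookup g k \<le> Poly_Mapping.lookup u k" for k
  proof (cases "k \<in> Poly_Mapping.keys g")
    case True
    then have "Poly_Mapping.lookup u k \<noteq> 0" using sub by (simp add: subset_iff in_keys_iff)
    moreover have "Poly_Mapping.lookup g k \<le> 1" using assms(1) by (simp add: squarefree_monomial_def)
    ultimately show ?thesis by linarith
  qed (simp add: in_keys_iff)
  then have "u = g + (u - g)" by (intro poly_mapping_eqI) (simp add: lookup_add lookup_minus)
  moreover have "Poly_Mapping.keys (u - g) \<subseteq> Poly_Mapping.keys u"
    by (auto simp: in_keys_iff lookup_minus)
  ultimately show "\<exists>v\<in>monomials n. u = g + v" using assms(2) unfolding monomials_def by blast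
qed

text \<open>A monomial \<open>u\<close> lies outside the ideal iff its support contains no generator's support, which is
  to say that the complement of its support is a cover. Any minimal cover inside this complement is
  a prime that does not contain \<open>u\<close>.\<close>

lemma multiples_squarefree_iff:
  assumes G: "G \<subseteq> monomials n" and sf: "\<And>g. g \<in> G \<Longrightarrow> squarefree_monomial g"
  shows "u \<in> multiples n G \<longleftrightarrow>
    u \<in> monomials n \<and> (\<forall>C. minimal_cover n G C \<longrightarrow> u \<in> heavy_monomials n C 1)"
proof (cases "u \<in> monomials n")
  case u: True
  have heavy: "u \<in> heavy_monomials n C 1 \<longleftrightarrow> C \<inter> Poly_Mapping.keys u \<noteq> {}" if "cover n G C" for C
    using that u heavy_monomials_one[of C u n] finite_subset[of C "{1..n}"] by (auto simp: cover_def)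
  have "u \<in> multiples n G \<longleftrightarrow> (\<exists>g\<in>G. \<exists>v\<in>monomials n. u = g + v)"
    by (auto simp: multiples_def)
  also have "\<dots> \<longleftrightarrow> (\<exists>g\<in>G. Poly_Mapping.keys g \<subseteq> Poly_Mapping.keys u)"
    by (intro bex_cong refl squarefree_multiples_iff sf u)
  also have "\<dots> \<longleftrightarrow> \<not> cover n G ({1..n} - Poly_Mapping.keys u)"
  proof -
    have "Poly_Mapping.keys g \<subseteq> Poly_Mapping.keys u \<longleftrightarrow>
        ({1..n} - Poly_Mapping.keys u) \<inter> Poly_Mapping.keys g = {}" if "g \<in> G" for g
    proof -
      have "Poly_Mapping.keys g \<subseteq> {1..n}" using G that by (auto simp: monomials_def)
      then show ?thesis by blast
    qed
    then show ?thesis by (simp add: cover_def)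
  qed
  also have "\<dots> \<longleftrightarrow> (\<forall>C. minimal_cover n G C \<longrightarrow> C \<inter> Poly_Mapping.keys u \<noteq> {})"
  proof
    assume no: "\<not> cover n G ({1..n} - Poly_Mapping.keys u)"
    show "\<forall>C. minimal_cover n G C \<longrightarrow> C \<inter> Poly_Mapping.keys u \<noteq> {}"
    proof (intro allI impI notI)
      fix C assume "minimal_cover n G C" "C \<inter> Poly_Mapping.keys u = {}"
      then have "cover n G C" "C \<subseteq> {1..n} - Poly_Mapping.keys u"
        by (auto simp: minimal_cover_def cover_def)
      then have "cover n G ({1..n} - Poly_Mapping.keys u)"
        by (rule cover_mono) simp
      with no show False by contradiction
    qed
  next
    assume all: "\<forall>C. minimal_cover n G C \<longrightarrow> C \<inter> Poly_Mapping.keys u \<noteq> {}"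
    show "\<not> cover n G ({1..n} - Poly_Mapping.keys u)"
    proof
      assume "cover n G ({1..n} - Poly_Mapping.keys u)"
      then obtain D where "D \<subseteq> {1..n} - Poly_Mapping.keys u" "minimal_cover n G D"
        by (rule minimal_cover_exists)
      then show False using all by blast
    qed
  qed
  also have "\<dots> \<longleftrightarrow> (\<forall>C. minimal_cover n G C \<longrightarrow> u \<in> heavy_monomials n C 1)"
    by (intro iff_allI imp_cong refl) (use heavy in \<open>simp add: minimal_cover_def\<close>)
  finally show ?thesis using u by simp
next
  case False
  then show ?thesis
    using multiple_closed_multiples[OF G] by (auto simp: multiple_closed_def)
qed

lemma carrier_Int_monomial_spans:
  "carrier (poly_ring n) \<inter> (\<Inter>C\<in>\<C>. monomial_span (W C)) =
    monomial_span {u \<in> monomials n. \<forall>C\<in>\<C>. u \<in> W C}"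
  by (auto simp: carrier_poly_ring monomial_span_def)

text \<open>Irredundancy is witnessed for each minimal cover \<open>C\<close> by the product of all variables outside \<open>C\<close>:
  it avoids the prime of \<open>C\<close>, but lies in the prime of any other minimal cover, since that cover is
  not contained in \<open>C\<close>.\<close>

lemma minimal_prime_decomposition_squarefree:
  fixes G n
  defines "Ps \<equiv> (\<lambda>C. monomial_span (heavy_monomials n C 1) :: 'k::field mpolynomial set)
      ` {C. minimal_cover n G C}"
  assumes G: "G \<subseteq> monomials n" and sf: "\<And>g. g \<in> G \<Longrightarrow> squarefree_monomial g"
  shows "minimal_prime_decomposition (poly_ring n) (Idl\<^bsub>poly_ring n\<^esub> (monomial_poly ` G)) Ps"
  unfolding minimal_prime_decomposition_def
proof (intro conjI ballI allI impI notI)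
  let ?P = "\<lambda>C. monomial_span (heavy_monomials n C 1) :: 'k mpolynomial set"
  let ?I = "Idl\<^bsub>poly_ring n\<^esub> (monomial_poly ` G) :: 'k mpolynomial set"
  have covC: "C \<subseteq> {1..n}" if "minimal_cover n G C" for C
    using that by (simp add: minimal_cover_def cover_def)
  have "{C. minimal_cover n G C} \<subseteq> Pow {1..n}" using covC by auto
  then have "finite {C. minimal_cover n G C}" by (rule finite_subset) simp
  then show "finite Ps" by (simp add: Ps_def)
  show "primeideal P (poly_ring n)" if "P \<in> Ps" for P
    using that primeideal_cover covC by (auto simp: Ps_def)
  have "multiples n G =
      {u \<in> monomials n. \<forall>C\<in>{C. minimal_cover n G C}. u \<in> heavy_monomials n C 1}"
    using multiples_squarefree_iff[OF G sf] by blast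
  then show I: "carrier (poly_ring n) \<inter> \<Inter>Ps = ?I"
    unfolding Ps_def carrier_Int_monomial_spans Idl_monomials[OF G] by simp
  fix Qs assume Qs: "Qs \<subset> Ps" and eq: "carrier (poly_ring n) \<inter> \<Inter>Qs = ?I"
  then obtain C where C: "minimal_cover n G C" "?P C \<notin> Qs" by (auto simp: Ps_def)
  define u where "u = variable_product ({1..n} - C)"
  have keys_u: "Poly_Mapping.keys u = {1..n} - C" by (simp add: u_def keys_variable_product)
  have u: "u \<in> monomials n" by (simp add: monomials_def keys_u)
  have "monomial_poly u \<in> Q" if Q: "Q \<in> Qs" for Q
  proof -
    obtain D where D: "minimal_cover n G D" "Q = ?P D" using Qs Q by (auto simp: Ps_def)
    then have "D \<noteq> C" using C(2) Q by blast
    then have "\<not> D \<subseteq> C" using C(1) D(1) by (auto simp: minimal_cover_def)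
    then have "D \<inter> Poly_Mapping.keys u \<noteq> {}" using covC[OF D(1)] keys_u by blast
    then show ?thesis
      using D u heavy_monomials_one[of D] finite_subset[OF covC[OF D(1)]] by simp
  qed
  then have "monomial_poly u \<in> ?I" using eq u by (auto simp: carrier_poly_ring)
  then have "monomial_poly u \<in> \<Inter>Ps" using I by blast
  then have "monomial_poly u \<in> ?P C" using C(1) unfolding Ps_def by blast
  then show False
    using heavy_monomials_one[of C] finite_subset[OF covC[OF C(1)]] keys_u by auto
qed

text \<open>The symbolic power is an intersection over the minimal covers. A cover has at least the exponent
  sum of any minimal cover inside it, so one may let \<open>C\<close> range over all covers, which are easier to
  recognise than minimal ones.\<close>

lemma symbolic_power_squarefree:
  assumes G: "G \<subseteq> monomials n" and sf: "\<And>g. g \<in> G \<Longrightarrow> squarefree_monomial g"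
  shows "symbolic_power (poly_ring n) (Idl\<^bsub>poly_ring n\<^esub> (monomial_poly ` G)) q =
    (monomial_span {u \<in> monomials n. \<forall>C. cover n G C \<longrightarrow> u \<in> heavy_monomials n C q}
      :: 'k::field mpolynomial set)"
proof -
  let ?Cs = "{C. minimal_cover n G C}"
  let ?P = "\<lambda>C. monomial_span (heavy_monomials n C 1) :: 'k mpolynomial set"
  have the: "(THE Ps. minimal_prime_decomposition (poly_ring n)
      (Idl\<^bsub>poly_ring n\<^esub> (monomial_poly ` G)) Ps) = ?P ` ?Cs"
    by (rule the_equality) (rule minimal_prime_decomposition_squarefree[OF G sf],
        assumption, erule minimal_prime_decomposition_unique,
        rule minimal_prime_decomposition_squarefree[OF G sf], assumption)
  have pow: "?P C [^]\<^bsub>ideals_set (poly_ring n)\<^esub> q = monomial_span (heavy_monomials n C q)"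
    if "C \<in> ?Cs" for C
    using that by (intro cover_prime_power) (simp add: minimal_cover_def cover_def)
  have mono: "u \<in> heavy_monomials n C q"
    if "D \<subseteq> C" "cover n G C" "u \<in> heavy_monomials n D q" for u C D
  proof -
    have "finite C" using that(2) finite_subset unfolding cover_def by blast
    then have "(\<Sum>k\<in>D. Poly_Mapping.lookup u k) \<le> (\<Sum>k\<in>C. Poly_Mapping.lookup u k)"
      using that(1) by (intro sum_mono2) auto
    then show ?thesis using that(3) by (simp add: heavy_monomials_def)
  qed
  have "symbolic_power (poly_ring n) (Idl\<^bsub>poly_ring n\<^esub> (monomial_poly ` G)) q =
      carrier (poly_ring n) \<inter> (\<Inter>C\<in>?Cs. ?P C [^]\<^bsub>ideals_set (poly_ring n)\<^esub> q)"
    by (simp add: symbolic_power_def the)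
  also have "\<dots> = carrier (poly_ring n) \<inter> (\<Inter>C\<in>?Cs. monomial_span (heavy_monomials n C q))"
    using pow by simp
  also have "\<dots> = monomial_span {u \<in> monomials n. \<forall>C\<in>?Cs. u \<in> heavy_monomials n C q}"
    by (rule carrier_Int_monomial_spans)
  also have "{u \<in> monomials n. \<forall>C\<in>?Cs. u \<in> heavy_monomials n C q} =
      {u \<in> monomials n. \<forall>C. cover n G C \<longrightarrow> u \<in> heavy_monomials n C q}"
  proof -
    have "(\<forall>C\<in>?Cs. u \<in> heavy_monomials n C q)
        \<longleftrightarrow> (\<forall>C. cover n G C \<longrightarrow> u \<in> heavy_monomials n C q)" for u
    proof
      assume all: "\<forall>C\<in>?Cs. u \<in> heavy_monomials n C q"
      show "\<forall>C. cover n G C \<longrightarrow> u \<in> heavy_monomials n C q"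
      proof (intro allI impI)
        fix C assume C: "cover n G C"
        then obtain D where "D \<subseteq> C" "minimal_cover n G D" by (rule minimal_cover_exists)
        then show "u \<in> heavy_monomials n C q" using all C mono by blast
      qed
    qed (simp add: minimal_cover_def)
    then show ?thesis by (rule_tac Collect_cong) blast
  qed
  finally show ?thesis .
qed

section \<open>The Waldschmidt constant as a linear program\<close>

text \<open>The feasible points of the linear program whose optimal value is the Waldschmidt constant:
  nonnegative weights on the variables that give every cover total weight at least 1.\<close>

definition cover_weightings :: "nat \<Rightarrow> monomial set \<Rightarrow> (nat \<Rightarrow> real) set" where
  "cover_weightings n G = {y. (\<forall>k. 0 \<le> y k) \<and> (\<forall>C. cover n G C \<longrightarrow> 1 \<le> (\<Sum>k\<in>C. y k))}"

lemma mdegree_monomials: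
  assumes "u \<in> monomials n"
  shows "mdegree u = (\<Sum>k=1..n. Poly_Mapping.lookup u k)"
  unfolding mdegree_def using assms
  by (intro sum.mono_neutral_left) (auto simp: monomials_def in_keys_iff)

lemma monomial_of_exponents:
  fixes c :: "nat \<Rightarrow> nat"
  obtains u where "u \<in> monomials n" "\<And>k. k \<in> {1..n} \<Longrightarrow> Poly_Mapping.lookup u k = c k"
proof (rule that[of "\<Sum>k=1..n. Poly_Mapping.single k (c k)"])
  have lk: "Poly_Mapping.lookup (\<Sum>k=1..n. Poly_Mapping.single k (c k)) j
      = (if j \<in> {1..n} then c j else 0)" for j
    by (simp add: lookup_sum lookup_single when_def)
  show "(\<Sum>k=1..n. Poly_Mapping.single k (c k)) \<in> monomials n"
    by (use lk in \<open>auto simp: monomials_def in_keys_iff split: if_splits\<close>)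
  show "Poly_Mapping.lookup (\<Sum>k=1..n. Poly_Mapping.single k (c k)) k = c k" if "k \<in> {1..n}" for k
    using that lk by simp
qed

text \<open>By the description of symbolic powers, \<open>\<alpha>(I\<^bsup>(q)\<^esup>)\<close> is the optimum of the integer program
  obtained from the linear one by asking for cover weights at least \<open>q\<close>. Dividing an integer solution
  by \<open>q\<close> gives a feasible weighting, whence \<open>\<alpha>(I\<^bsup>(q)\<^esup>) / q\<close> is never below the infimum. Multiplying a
  weighting by \<open>q\<close> and rounding up costs at most \<open>1\<close> per variable, which is \<open>n / q\<close> after division by
  \<open>q\<close> and tends to 0. This also proves that the limit exists.\<close>

lemma waldschmidt_squarefree:
  assumes G: "G \<subseteq> monomials n" and sf: "\<And>g. g \<in> G \<Longrightarrow> squarefree_monomial g" and ne: "G \<noteq> {}"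
  shows "waldschmidt n (Idl\<^bsub>poly_ring n\<^esub> (monomial_poly ` G) :: 'k::field mpolynomial set) =
    Inf ((\<lambda>y. \<Sum>k=1..n. y k) ` cover_weightings n G)"
proof -
  let ?I = "Idl\<^bsub>poly_ring n\<^esub> (monomial_poly ` G) :: 'k mpolynomial set"
  define W where "W q = {u \<in> monomials n. \<forall>C. cover n G C \<longrightarrow> u \<in> heavy_monomials n C q}" for q
  define a where "a q = alpha n (symbolic_power (poly_ring n) ?I q)" for q
  define S where "S = (\<lambda>y. \<Sum>k=1..n. y k) ` cover_weightings n G"
  have fin: "finite C" and Cn: "C \<subseteq> {1..n}" if "cover n G C" for C
    using that finite_subset[of C "{1..n}"] by (auto simp: cover_def)
  have "multiple_closed n (W q)" for q
    using multiple_closed_heavy[of n _ q] monomials_add[of _ n]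
    by (auto simp: multiple_closed_def W_def)
  then have a: "a q = (LEAST d. d \<in> mdegree ` W q)" for q
    unfolding a_def W_def using symbolic_power_squarefree[OF G sf, of q, where 'k = 'k]
    by (simp add: alpha_monomial_span)
  have W_iff: "u \<in> W q \<longleftrightarrow>
      u \<in> monomials n \<and> (\<forall>C. cover n G C \<longrightarrow> q \<le> (\<Sum>k\<in>C. Poly_Mapping.lookup u k))" for u q
    by (auto simp: W_def heavy_monomials_def)
  have upper: "real (a q) \<le> real q * (\<Sum>k=1..n. y k) + real n" if y: "y \<in> cover_weightings n G" for y q
  proof -
    define c where "c k = nat \<lceil>real q * y k\<rceil>" for k
    have y0: "0 \<le> y k" for k using y by (simp add: cover_weightings_def)
    have c: "real q * y k \<le> real (c k)" "real (c k) \<le> real q * y k + 1" for k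
      using y0[of k] unfolding c_def by (simp_all add: real_nat_ceiling_ge)
    obtain u where u: "u \<in> monomials n" "\<And>k. k \<in> {1..n} \<Longrightarrow> Poly_Mapping.lookup u k = c k"
      by (rule monomial_of_exponents[where c = c]) auto
    have "q \<le> (\<Sum>k\<in>C. Poly_Mapping.lookup u k)" if C: "cover n G C" for C
    proof -
      have "real q * 1 \<le> real q * (\<Sum>k\<in>C. y k)"
        using y C by (intro mult_left_mono) (auto simp: cover_weightings_def)
      also have "\<dots> = (\<Sum>k\<in>C. real q * y k)" by (simp add: sum_distrib_left)
      also have "\<dots> \<le> (\<Sum>k\<in>C. real (c k))" by (intro sum_mono c)
      also have "\<dots> = real (\<Sum>k\<in>C. c k)" by simp
      also have "(\<Sum>k\<in>C. c k) = (\<Sum>k\<in>C. Poly_Mapping.lookup u k)"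
        using u(2) Cn[OF C] by (intro sum.cong) auto
      finally show ?thesis by linarith
    qed
    then have "u \<in> W q" using u(1) by (simp add: W_iff)
    then have "a q \<le> mdegree u" unfolding a by (intro Least_le) auto
    also have "mdegree u = (\<Sum>k=1..n. c k)" using u by (simp add: mdegree_monomials)
    finally have "real (a q) \<le> (\<Sum>k=1..n. real (c k))" by (simp flip: of_nat_sum)
    also have "\<dots> \<le> (\<Sum>k=1..n. real q * y k + 1)" by (intro sum_mono c)
    also have "\<dots> = real q * (\<Sum>k=1..n. y k) + real n" by (simp add: sum.distrib sum_distrib_left)
    finally show ?thesis .
  qed
  have "(\<lambda>_. 1) \<in> cover_weightings n G"
  proof -
    have "C \<noteq> {}" if "cover n G C" for C using that ne by (auto simp: cover_def)
    then have "1 \<le> card C" if "cover n G C" for C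
      using that fin by (metis One_nat_def Suc_leI card_gt_0_iff)
    then show ?thesis by (simp add: cover_weightings_def)
  qed
  then have S_ne: "S \<noteq> {}" by (auto simp: S_def)
  have "\<And>s. s \<in> S \<Longrightarrow> 0 \<le> s" by (auto simp: S_def cover_weightings_def intro: sum_nonneg)
  then have bdd: "bdd_below S" by (rule bdd_belowI)
  have W_ne: "W q \<noteq> {}" for q
  proof -
    obtain u where u: "u \<in> monomials n" "\<And>k. k \<in> {1..n} \<Longrightarrow> Poly_Mapping.lookup u k = q"
      by (rule monomial_of_exponents[where c = "\<lambda>_. q"]) auto
    have "q \<le> (\<Sum>k\<in>C. Poly_Mapping.lookup u k)" if C: "cover n G C" for C
    proof -
      obtain k where k: "k \<in> C" using C ne by (auto simp: cover_def)
      then have "q = Poly_Mapping.lookup u k" using u(2) Cn[OF C] by auto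
      also have "\<dots> \<le> (\<Sum>k\<in>C. Poly_Mapping.lookup u k)"
        using fin[OF C] k by (intro member_le_sum) auto
      finally show ?thesis .
    qed
    then have "u \<in> W q" using u(1) by (simp add: W_iff)
    then show ?thesis by blast
  qed
  have lower: "real q * Inf S \<le> real (a q)" if q: "0 < q" for q
  proof -
    obtain u0 where "u0 \<in> W q" using W_ne[of q] by blast
    then have "mdegree u0 \<in> mdegree ` W q" by simp
    then have "a q \<in> mdegree ` W q" unfolding a by (rule LeastI)
    then obtain u where u: "u \<in> W q" "a q = mdegree u" by blast
    define y where "y k = real (Poly_Mapping.lookup u k) / real q" for k
    have "1 \<le> (\<Sum>k\<in>C. y k)" if "cover n G C" for C
    proof -
      have "q \<le> (\<Sum>k\<in>C. Poly_Mapping.lookup u k)" using u(1) that by (simp add: W_iff)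
      then have "real q \<le> (\<Sum>k\<in>C. real (Poly_Mapping.lookup u k))"
        by (metis of_nat_le_iff of_nat_sum)
      then show ?thesis using q by (simp add: y_def field_simps flip: sum_divide_distrib)
    qed
    then have "y \<in> cover_weightings n G" by (simp add: cover_weightings_def y_def)
    then have "Inf S \<le> (\<Sum>k=1..n. y k)" using bdd by (intro cInf_lower) (auto simp: S_def)
    also have "\<dots> = real (a q) / real q"
      using u mdegree_monomials[of u n] by (simp add: y_def W_iff flip: sum_divide_distrib)
    finally show ?thesis using q by (simp add: field_simps)
  qed
  have "(\<lambda>q. real (a q) / real q) \<longlonglongrightarrow> Inf S"
  proof (rule order_tendstoI)
    fix b assume b: "b < Inf S"
    show "\<forall>\<^sub>F q in sequentially. b < real (a q) / real q"
      using eventually_gt_at_top[of 0]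
    proof eventually_elim
      case (elim q)
      then have "Inf S \<le> real (a q) / real q" using lower[of q] by (simp add: field_simps)
      then show ?case using b by linarith
    qed
  next
    fix b assume b: "Inf S < b"
    then obtain y where y: "y \<in> cover_weightings n G" "(\<Sum>k=1..n. y k) < b"
      using cInf_lessD[OF S_ne b] by (auto simp: S_def)
    have "(\<lambda>q. (\<Sum>k=1..n. y k) + real n / real q) \<longlonglongrightarrow> (\<Sum>k=1..n. y k) + 0"
      by (intro tendsto_intros lim_const_over_n)
    then have "\<forall>\<^sub>F q in sequentially. (\<Sum>k=1..n. y k) + real n / real q < b"
      using y(2) by (intro order_tendstoD) auto
    then show "\<forall>\<^sub>F q in sequentially. real (a q) / real q < b"
      using eventually_gt_at_top[of 0]
    proof eventually_elim
      case (elim q)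
      then have "real (a q) / real q \<le> (\<Sum>k=1..n. y k) + real n / real q"
        using upper[OF y(1), of q] by (simp add: field_simps)
      then show ?case using elim by linarith
    qed
  qed
  then show ?thesis unfolding waldschmidt_def a_def S_def by (rule limI)
qed

lemma waldschmidt_le:
  assumes "G \<subseteq> monomials n" "\<And>g. g \<in> G \<Longrightarrow> squarefree_monomial g" "G \<noteq> {}"
    and y: "y \<in> cover_weightings n G"
  shows "waldschmidt n (Idl\<^bsub>poly_ring n\<^esub> (monomial_poly ` G) :: 'k::field mpolynomial set)
    \<le> (\<Sum>k=1..n. y k)"
proof -
  have "bdd_below ((\<lambda>y. \<Sum>k=1..n. y k) ` cover_weightings n G)"
    by (rule bdd_belowI[of _ 0]) (auto simp: cover_weightings_def intro: sum_nonneg)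
  then show ?thesis
    using y by (subst waldschmidt_squarefree[OF assms(1-3)]) (auto intro: cInf_lower)
qed

lemma le_waldschmidt:
  assumes "G \<subseteq> monomials n" "\<And>g. g \<in> G \<Longrightarrow> squarefree_monomial g" "G \<noteq> {}"
    and "cover_weightings n G \<noteq> {}"
    and "\<And>y. y \<in> cover_weightings n G \<Longrightarrow> v \<le> (\<Sum>k=1..n. y k)"
  shows "v \<le> waldschmidt n (Idl\<^bsub>poly_ring n\<^esub> (monomial_poly ` G) :: 'k::field mpolynomial set)"
  using assms(4,5) by (subst waldschmidt_squarefree[OF assms(1-3)]) (auto intro!: cInf_greatest)

section \<open>Covers of square-free principal Borel ideals\<close>

definition borel_generators :: "monomial \<Rightarrow> monomial set" where
  "borel_generators m = {m'. squarefree_monomial m' \<and> borel_move m m'}"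

text \<open>Each factor \<open>x\<^sub>a / x\<^sub>b\<close> moves one unit of exponent to a smaller index, so the number of
  variables with index at most \<open>c\<close>, counted with multiplicity, cannot drop.\<close>

lemma borel_move_count:
  assumes "borel_move m m'"
  shows "(\<Sum>k\<le>c. Poly_Mapping.lookup m k) \<le> (\<Sum>k\<le>c. Poly_Mapping.lookup m' k)"
proof -
  define w :: "monomial \<Rightarrow> nat" where "w u = (\<Sum>k\<le>c. Poly_Mapping.lookup u k)" for u
  have add: "w (u + v) = w u + w v" for u v by (simp add: w_def lookup_add sum.distrib)
  have single: "w (Poly_Mapping.single k 1) = (if k \<le> c then 1 else 0)" for k
    by (simp add: w_def lookup_single when_def)
  obtain ps where ps: "\<forall>(a, b) \<in> set ps. 1 \<le> a \<and> a < b \<and> b \<in> Poly_Mapping.keys m"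
    and eq: "m' + (\<Sum>(a, b)\<leftarrow>ps. Poly_Mapping.single b 1) = m + (\<Sum>(a, b)\<leftarrow>ps. Poly_Mapping.single a 1)"
    using assms by (auto simp: borel_move_def)
  have "\<forall>(a, b) \<in> set ps. a < b" using ps by auto
  then have "w (\<Sum>(a, b)\<leftarrow>ps. Poly_Mapping.single b 1) \<le> w (\<Sum>(a, b)\<leftarrow>ps. Poly_Mapping.single a 1)"
  proof (induction ps)
    case Nil
    then show ?case by simp
  next
    case (Cons p ps)
    then show ?case by (cases p) (use single in \<open>auto simp: add intro!: add_mono\<close>)
  qed
  moreover have "w m' + w (\<Sum>(a, b)\<leftarrow>ps. Poly_Mapping.single b 1)
      = w m + w (\<Sum>(a, b)\<leftarrow>ps. Poly_Mapping.single a 1)"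
    using arg_cong[OF eq, of w] by (simp only: add)
  ultimately show ?thesis by (simp add: w_def)
qed

lemma single_in_monomials: "Poly_Mapping.single k 1 \<in> monomials n \<longleftrightarrow> k \<in> {1..n}"
  by (simp add: monomials_def)

lemma borel_move_monomials:
  assumes m: "m \<in> monomials n" and move: "borel_move m m'"
  shows "m' \<in> monomials n"
proof -
  obtain ps where ps: "\<forall>(a, b) \<in> set ps. 1 \<le> a \<and> a < b \<and> b \<in> Poly_Mapping.keys m"
    and eq: "m' + (\<Sum>(a, b)\<leftarrow>ps. Poly_Mapping.single b 1) = m + (\<Sum>(a, b)\<leftarrow>ps. Poly_Mapping.single a 1)"
    using move by (auto simp: borel_move_def)
  have "\<forall>(a, b) \<in> set ps. a \<in> {1..n}" using ps m by (fastforce simp: monomials_def)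
  then have "(\<Sum>(a, b)\<leftarrow>ps. Poly_Mapping.single a 1) \<in> monomials n"
  proof (induction ps)
    case Nil
    then show ?case by simp
  next
    case (Cons p ps)
    then show ?case by (cases p) (use single_in_monomials in \<open>auto intro!: monomials_add\<close>)
  qed
  then have "m' + (\<Sum>(a, b)\<leftarrow>ps. Poly_Mapping.single b 1) \<in> monomials n"
    unfolding eq using m by (intro monomials_add)
  then show ?thesis by (auto simp: monomials_def in_keys_iff lookup_add subset_iff)
qed

lemma squarefree_variable_product: "finite A \<Longrightarrow> squarefree_monomial (variable_product A)"
  by (simp add: squarefree_monomial_def lookup_variable_product)

lemma borel_move_injection:
  fixes i j :: "nat \<Rightarrow> nat" and s :: nat
  assumes i: "inj_on i {1..s}" and j: "inj_on j {1..s}"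
    and le: "\<And>p. p \<in> {1..s} \<Longrightarrow> 1 \<le> j p \<and> j p \<le> i p"
  shows "borel_move (variable_product (i ` {1..s})) (variable_product (j ` {1..s}))"
proof -
  \<comment> \<open>Pairs in a Borel move satisfy \<open>a < b\<close>, so the positions with \<open>j p = i p\<close> are left out.\<close>
  define F where "F = {p \<in> {1..s}. j p < i p}"
  define ps where "ps = map (\<lambda>p. (j p, i p)) (sorted_list_of_set F)"
  let ?x = "\<lambda>k. Poly_Mapping.single k 1 :: monomial"
  have F: "finite F" "F \<subseteq> {1..s}" by (auto simp: F_def)
  have sums: "(\<Sum>(a, b)\<leftarrow>ps. ?x a) = (\<Sum>p\<in>F. ?x (j p))" "(\<Sum>(a, b)\<leftarrow>ps. ?x b) = (\<Sum>p\<in>F. ?x (i p))"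
    using F(1) by (simp_all add: ps_def comp_def sum_list_distinct_conv_sum_set)
  have rest: "(\<Sum>p\<in>{1..s} - F. ?x (j p)) = (\<Sum>p\<in>{1..s} - F. ?x (i p))"
  proof (rule sum.cong)
    fix p assume "p \<in> {1..s} - F"
    then have "j p = i p" using le[of p] by (auto simp: F_def)
    then show "?x (j p) = ?x (i p)" by simp
  qed simp
  have split: "(\<Sum>p\<in>{1..s}. ?x (h p)) = (\<Sum>p\<in>{1..s} - F. ?x (h p)) + (\<Sum>p\<in>F. ?x (h p))" for h
    using F by (intro sum.subset_diff) auto
  have vp: "variable_product (i ` {1..s}) = (\<Sum>p\<in>{1..s}. ?x (i p))"
    "variable_product (j ` {1..s}) = (\<Sum>p\<in>{1..s}. ?x (j p))"
    using i j by (simp_all add: variable_product_def sum.reindex)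
  show ?thesis
    unfolding borel_move_def
  proof (intro exI[of _ ps] conjI)
    show "\<forall>(a, b)\<in>set ps. 1 \<le> a \<and> a < b \<and> b \<in> Poly_Mapping.keys (variable_product (i ` {1..s}))"
    proof -
      have "1 \<le> j p \<and> j p < i p \<and> i p \<in> i ` {1..s}" if "p \<in> F" for p
        using that le[of p] by (simp add: F_def)
      then show ?thesis using F(1) by (auto simp: ps_def keys_variable_product)
    qed
    show "variable_product (j ` {1..s}) + (\<Sum>(a, b)\<leftarrow>ps. ?x b)
        = variable_product (i ` {1..s}) + (\<Sum>(a, b)\<leftarrow>ps. ?x a)"
      unfolding vp sums by (simp only: split[of i] split[of j] rest ac_simps)
  qed
qed

text \<open>The values \<open>j 1, j 2, \<dots>\<close> can be chosen one after the other: the hypothesis for \<open>p\<close> says that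
  the \<open>p - 1\<close> earlier choices do not exhaust the candidates for \<open>j p\<close>.\<close>

lemma greedy_injection:
  fixes i :: "nat \<Rightarrow> nat"
  assumes "\<And>p. p \<in> {1..s} \<Longrightarrow> p \<le> card (D \<inter> {..i p})"
  shows "\<exists>j. inj_on j {1..s} \<and> (\<forall>p\<in>{1..s}. j p \<in> D \<inter> {..i p})"
  using assms
proof (induction s)
  case 0
  then show ?case by simp
next
  case (Suc s)
  then obtain j where j: "inj_on j {1..s}" "\<forall>p\<in>{1..s}. j p \<in> D \<inter> {..i p}" by force
  have "card (j ` {1..s}) < card (D \<inter> {..i (Suc s)})"
    using Suc.prems[of "Suc s"] card_image_le[of "{1..s}" j] by simp
  then have "\<not> D \<inter> {..i (Suc s)} \<subseteq> j ` {1..s}"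
    using card_mono[of "j ` {1..s}" "D \<inter> {..i (Suc s)}"] by auto
  then obtain x where x: "x \<in> D \<inter> {..i (Suc s)}" "x \<notin> j ` {1..s}" by blast
  have eq: "(j(Suc s := x)) p = j p" if "p \<in> {1..s}" for p using that by auto
  have "inj_on (j(Suc s := x)) {1..s}" by (rule iffD2[OF inj_on_cong[OF eq] j(1)])
  moreover have "(j(Suc s := x)) ` {1..s} = j ` {1..s}" using eq by (intro image_cong) auto
  ultimately have "inj_on (j(Suc s := x)) (insert (Suc s) {1..s})"
    using x(2) by (subst inj_on_insert) auto
  moreover have "\<forall>p\<in>insert (Suc s) {1..s}. (j(Suc s := x)) p \<in> D \<inter> {..i p}"
    using x(1) j(2) by auto
  moreover have "insert (Suc s) {1..s} = {1..Suc s}" by auto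
  ultimately show ?case by metis
qed

text \<open>If the complement of \<open>C\<close> has at least \<open>p\<close> elements up to \<open>i p\<close> for every \<open>p\<close>, the greedy choice
  produces a generator supported there, so \<open>C\<close> is no cover. Conversely every generator has at
  least \<open>p\<close> variables up to \<open>i p\<close>, because \<open>m\<close> has and Borel moves preserve this; if the complement of
  \<open>C\<close> has fewer, one of these variables belongs to \<open>C\<close>.\<close>

lemma cover_borel_iff:
  assumes i: "strict_mono_on {1..s} i" and i1: "\<And>p. p \<in> {1..s} \<Longrightarrow> i p \<in> {1..n}"
    and C: "C \<subseteq> {1..n}"
  shows "cover n (borel_generators (variable_product (i ` {1..s}))) C \<longleftrightarrow>
    (\<exists>p\<in>{1..s}. card ({1..i p} - C) < p)"
proof
  let ?m = "variable_product (i ` {1..s})"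
  have inj: "inj_on i {1..s}" using i by (rule strict_mono_on_imp_inj_on)
  have m: "?m \<in> monomials n" using i1 by (auto simp: monomials_def keys_variable_product)
  {
    assume cov: "cover n (borel_generators ?m) C"
    show "\<exists>p\<in>{1..s}. card ({1..i p} - C) < p"
    proof (rule ccontr)
      assume "\<not> ?thesis"
      moreover have "({1..n} - C) \<inter> {..i p} = {1..i p} - C" if "p \<in> {1..s}" for p
        using i1[OF that] by auto
      ultimately have "\<And>p. p \<in> {1..s} \<Longrightarrow> p \<le> card (({1..n} - C) \<inter> {..i p})"
        by (simp add: not_less)
      then obtain j where j: "inj_on j {1..s}" "\<forall>p\<in>{1..s}. j p \<in> ({1..n} - C) \<inter> {..i p}"
        using greedy_injection[of s "{1..n} - C" i] by blast
      have "borel_move ?m (variable_product (j ` {1..s}))"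
        using inj j by (intro borel_move_injection) auto
      then have "variable_product (j ` {1..s}) \<in> borel_generators ?m"
        by (simp add: borel_generators_def squarefree_variable_product)
      then have "C \<inter> j ` {1..s} \<noteq> {}"
        using cov by (force simp: cover_def keys_variable_product)
      then show False using j(2) by auto
    qed
  next
    assume "\<exists>p\<in>{1..s}. card ({1..i p} - C) < p"
    then obtain p where p: "p \<in> {1..s}" "card ({1..i p} - C) < p" by blast
    have "C \<inter> Poly_Mapping.keys g \<noteq> {}" if "g \<in> borel_generators ?m" for g
    proof
      assume disj: "C \<inter> Poly_Mapping.keys g = {}"
      have g: "borel_move ?m g" "squarefree_monomial g"
        using that by (simp_all add: borel_generators_def)
      have count: "(\<Sum>k\<le>c. Poly_Mapping.lookup u k) = card (Poly_Mapping.keys u \<inter> {..c})"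
        if "squarefree_monomial u" for u c
      proof -
        have "Poly_Mapping.lookup u k = (if k \<in> Poly_Mapping.keys u then 1 else 0)" for k
          using spec[OF that[unfolded squarefree_monomial_def], of k] by (auto simp: in_keys_iff)
        then have "(\<Sum>k\<le>c. Poly_Mapping.lookup u k) = (\<Sum>k\<in>{..c}. if k \<in> Poly_Mapping.keys u then 1 else 0)"
          by (intro sum.cong) auto
        also have "\<dots> = card ({..c} \<inter> Poly_Mapping.keys u)" by (simp add: sum.If_cases)
        finally show ?thesis by (simp add: Int_commute)
      qed
      have "i q \<le> i p" if "q \<in> {1..p}" for q
        using strict_mono_on_leD[OF i, of q p] that p(1) by auto
      then have "i ` {1..p} \<subseteq> Poly_Mapping.keys ?m \<inter> {..i p}"
        using p(1) by (auto simp: keys_variable_product)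
      then have "card (i ` {1..p}) \<le> card (Poly_Mapping.keys ?m \<inter> {..i p})"
        by (intro card_mono) auto
      moreover have "card (i ` {1..p}) = p"
        using inj_on_subset[OF inj, of "{1..p}"] p(1) by (simp add: card_image)
      ultimately have "p \<le> card (Poly_Mapping.keys ?m \<inter> {..i p})" by simp
      also have "\<dots> \<le> card (Poly_Mapping.keys g \<inter> {..i p})"
        using borel_move_count[OF g(1), of "i p"] by (simp add: count g squarefree_variable_product)
      also have "\<dots> \<le> card ({1..i p} - C)"
        using borel_move_monomials[OF m g(1)] disj
        by (intro card_mono) (auto simp: monomials_def)
      finally show False using p(2) by simp
    qed
    then show "cover n (borel_generators ?m) C" using C by (simp add: cover_def)
  }
qed

text \<open>The \<open>k\<close> largest of the values \<open>y\<close> on \<open>T\<close> have at least the average of all of them: removing a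
  smallest value never lowers the average.\<close>

lemma heavy_subset:
  fixes y :: "'a \<Rightarrow> real"
  assumes "finite T" "k \<le> card T"
  obtains U where "U \<subseteq> T" "card U = k" "real k * sum y T \<le> real (card T) * sum y U"
proof -
  have "\<exists>U\<subseteq>T. card U = k \<and> real k * sum y T \<le> real (card T) * sum y U"
  proof (cases "k = 0")
    case False
    show ?thesis using assms
    proof (induction "card T" arbitrary: T)
      case 0
      then show ?case using False by simp
    next
      case (Suc t)
      show ?case
      proof (cases "k = card T")
        case True
        then show ?thesis by blast
      next
        case less: False
        have "T \<noteq> {}" using Suc.hyps(2) by auto
        then obtain x where x: "x \<in> T" "\<And>z. z \<in> T \<Longrightarrow> y x \<le> y z"
          using that[of "arg_min_on y T"] Suc.prems(1) arg_min_if_finite(1)[of T y]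
            arg_min_least[of T _ y] by blast
        have t: "card (T - {x}) = t" using Suc x by simp
        have "k \<le> t" using less Suc.hyps(2) Suc.prems(2) by simp
        then obtain U where U: "U \<subseteq> T - {x}" "card U = k"
          "real k * sum y (T - {x}) \<le> real t * sum y U"
          using Suc.hyps(1)[of "T - {x}"] t Suc.prems(1) by auto
        have "real (card T) * y x \<le> sum y T"
          using sum_bounded_below[of T "y x" y] x(2) by simp
        then have "real t * sum y T \<le> real (card T) * (sum y T - y x)"
          using Suc.hyps(2)[symmetric] by (simp add: algebra_simps)
        also have "sum y T - y x = sum y (T - {x})" using Suc.prems(1) x(1) by (simp add: sum_diff1)
        finally have "real k * (real t * sum y T) \<le> real k * (real (card T) * sum y (T - {x}))"
          by (intro mult_left_mono) auto
        also have "\<dots> = real (card T) * (real k * sum y (T - {x}))" by simp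
        also have "\<dots> \<le> real (card T) * (real t * sum y U)" using U(3) by (intro mult_left_mono) auto
        finally have "real t * (real k * sum y T) \<le> real t * (real (card T) * sum y U)"
          by (simp add: mult_ac)
        moreover have "0 < t" using \<open>k \<le> t\<close> False by simp
        ultimately have "real k * sum y T \<le> real (card T) * sum y U" by simp
        then show ?thesis using U by blast
      qed
    qed
  qed auto
  then show ?thesis using that by blast
qed

section \<open>Solving the linear program\<close>

text \<open>The weighting that yields the upper bound. Multiplied by \<open>a d\<close>, it is \<open>d\<close> on the first \<open>a\<close> variables
  and 1 on the next ones up to \<open>N = a d + s - 1\<close>. A cover misses fewer than \<open>p\<close> elements of some
  initial segment \<open>{1..i p}\<close>, where the total weight is \<open>a d + min (i p) N - a\<close>. If \<open>e\<close> of the missed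
  elements are among the first \<open>a\<close> and \<open>r\<close> are not, they weigh at most \<open>e d + r\<close>. So the point is the
  inequality \<open>e d + r \<le> min (i p) N - a\<close> when \<open>e \<le> a\<close> and \<open>e + r < p\<close>: since \<open>d \<ge> 1\<close>, the worst
  case is \<open>e\<close> as large as possible, namely \<open>min a (p - 1)\<close>, and there the lower bounds on \<open>i p\<close> suffice.\<close>

lemma borel_cover_weighting:
  fixes i :: "nat \<Rightarrow> nat" and a d s n :: nat
  defines "y \<equiv> \<lambda>k. if k \<in> {1..a} then 1 / real a
    else if k \<in> {a+1..a * d + s - 1} then 1 / real (a * d) else 0"
  assumes i: "strict_mono_on {1..s} i" and i1: "\<And>p. p \<in> {1..s} \<Longrightarrow> i p \<in> {1..n}"
    and a: "0 < a" "a < s" and d: "0 < d"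
    and gap: "\<And>p. p \<in> {1..a+1} \<Longrightarrow> a + (p - 1) * d \<le> i p"
  shows "y \<in> cover_weightings n (borel_generators (variable_product (i ` {1..s})))"
    and "(\<Sum>k=1..n. y k) = 2 + (real s - real a - 1) / (real a * real d)"
proof -
  define N where "N = a * d + s - 1"
  define w :: "nat \<Rightarrow> nat" where "w k = (if k \<in> {1..a} then d else if k \<in> {a+1..N} then 1 else 0)" for k
  have y: "y k = real (w k) / real (a * d)" for k
    using a d by (auto simp: y_def w_def N_def field_simps)
  have aN: "a \<le> N" using a by (simp add: N_def)
  have wsum: "(\<Sum>k=1..M. w k) = a * d + (min M N - a)" if "a \<le> M" for M
  proof -
    have "(\<Sum>k=1..M. w k) = (\<Sum>k=1..a. w k) + (\<Sum>k=a+1..M. w k)"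
      using that sum.ub_add_nat[of 1 a w "M - a"] by simp
    also have "(\<Sum>k=1..a. w k) = a * d" by (simp add: w_def)
    also have "(\<Sum>k=a+1..M. w k) = (\<Sum>k\<in>{a+1..min M N}. 1)"
      by (rule sum.mono_neutral_cong_right) (auto simp: w_def)
    finally show ?thesis by simp
  qed
  \<comment> \<open>Beyond \<open>p = a + 1\<close> the sequence grows by at least 1 per step.\<close>
  have tail: "a + a * d + (p - (a + 1)) \<le> i p" if "p \<in> {a+1..s}" for p
    using that
  proof (induction p)
    case (Suc p)
    show ?case
    proof (cases "p = a")
      case True
      then show ?thesis using gap[of "a + 1"] by simp
    next
      case False
      then have p: "p \<in> {a+1..s}" using Suc.prems by auto
      have "i p < i (Suc p)"
        using strict_mono_onD[OF i, of p "Suc p"] Suc.prems p by auto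
      then show ?thesis using Suc.IH[OF p] p by (simp add: Suc_diff_le)
    qed
  qed simp
  \<comment> \<open>Up to \<open>p = a + 1\<close> all missed elements may be heavy; beyond that at most \<open>a\<close> of them are.\<close>
  have gap': "e * d + r \<le> min (i p) N - a" if p: "p \<in> {1..s}" and er: "e \<le> a" "e + r < p" for p e r
  proof (cases "p \<le> a + 1")
    case True
    have "e * d + r \<le> (e + r) * d" using d by (simp add: algebra_simps)
    also have le: "\<dots> \<le> (p - 1) * d" using er by (intro mult_right_mono) auto
    finally have "e * d + r \<le> (p - 1) * d" .
    moreover have "(p - 1) * d \<le> i p - a" using gap[of p] p True by auto
    moreover have "(p - 1) * d \<le> N - a"
    proof -
      have "(p - 1) * d \<le> a * d" using True by (intro mult_right_mono) auto
      moreover have "N - a = a * d + (s - 1 - a)" using a by (simp add: N_def)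
      ultimately show ?thesis by linarith
    qed
    ultimately show ?thesis by simp
  next
    case False
    obtain f where f: "a = e + f" using er(1) le_Suc_ex by blast
    have "f \<le> f * d" using d by simp
    moreover have "a * d = e * d + f * d" using f by (simp add: algebra_simps)
    ultimately have "e * d + r \<le> a * d + (p - (a + 1))" using er(2) False f by linarith
    moreover have "a * d + (p - (a + 1)) \<le> i p - a" using tail[of p] p False by auto
    moreover have "a * d + (p - (a + 1)) \<le> N - a" using p a by (auto simp: N_def)
    ultimately show ?thesis by simp
  qed
  have iN: "a \<le> i p" if "p \<in> {1..s}" for p
    using strict_mono_on_leD[OF i, of 1 p] gap[of 1] that by auto
  have Nn: "N \<le> n" using tail[of s] i1[of s] a by (auto simp: N_def)
  have "a * d \<le> (\<Sum>k\<in>C. w k)"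
    if cov: "cover n (borel_generators (variable_product (i ` {1..s}))) C" for C
  proof -
    have C: "C \<subseteq> {1..n}" using cov by (simp add: cover_def)
    then have "\<exists>p\<in>{1..s}. card ({1..i p} - C) < p"
      using cov cover_borel_iff[OF i, where C = C] i1 by blast
    then obtain p where p: "p \<in> {1..s}" "card ({1..i p} - C) < p" by blast
    define D where "D = {1..i p} - C"
    define e where "e = card (D \<inter> {1..a})"
    define r where "r = card (D - {1..a})"
    have fin: "finite D" "finite C" using C finite_subset by (auto simp: D_def)
    have "e + r = card D"
      using card_Un_disjoint[of "D \<inter> {1..a}" "D - {1..a}"] fin(1)
      by (simp add: e_def r_def Int_Diff_Un) (metis Int_Diff_Un Int_Diff_disjoint)
    then have er: "e + r < p" using p(2) by (simp add: D_def)
    have ea: "e \<le> a" using card_mono[of "{1..a}" "D \<inter> {1..a}"] by (simp add: e_def)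
    have "(\<Sum>k\<in>D. w k) = (\<Sum>k\<in>D \<inter> {1..a}. w k) + (\<Sum>k\<in>D - {1..a}. w k)"
      using fin(1) by (rule sum.Int_Diff)
    also have "(\<Sum>k\<in>D \<inter> {1..a}. w k) = e * d" by (simp add: w_def e_def)
    also have "(\<Sum>k\<in>D - {1..a}. w k) \<le> (\<Sum>k\<in>D - {1..a}. 1)"
      by (intro sum_mono) (auto simp: w_def)
    finally have D: "(\<Sum>k\<in>D. w k) \<le> e * d + r" by (simp add: r_def)
    have "a * d + (min (i p) N - a) = (\<Sum>k=1..i p. w k)" using wsum[OF iN[OF p(1)]] by simp
    also have "\<dots> = (\<Sum>k\<in>{1..i p} \<inter> C. w k) + (\<Sum>k\<in>D. w k)"
      unfolding D_def by (rule sum.Int_Diff) simp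
    also have "(\<Sum>k\<in>{1..i p} \<inter> C. w k) \<le> (\<Sum>k\<in>C. w k)"
      using fin(2) by (intro sum_mono2) auto
    finally show ?thesis using D gap'[OF p(1) ea er] by linarith
  qed
  then have "real (a * d) \<le> real (\<Sum>k\<in>C. w k)"
    if "cover n (borel_generators (variable_product (i ` {1..s}))) C" for C
    using that of_nat_le_iff by blast
  then have "1 \<le> (\<Sum>k\<in>C. y k)"
    if "cover n (borel_generators (variable_product (i ` {1..s}))) C" for C
    using that a d unfolding y sum_divide_distrib[symmetric] by (simp add: field_simps)
  then show "y \<in> cover_weightings n (borel_generators (variable_product (i ` {1..s})))"
    by (simp add: cover_weightings_def y)
  have "(\<Sum>k=1..n. y k) = real (\<Sum>k=1..n. w k) / real (a * d)"
    by (simp add: y sum_divide_distrib)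
  also have "(\<Sum>k=1..n. w k) = 2 * (a * d) + (s - 1 - a)"
    using wsum[of n] aN Nn a by (simp add: N_def)
  also have "real \<dots> / real (a * d) = 2 + (real s - real a - 1) / (real a * real d)"
    using a d by (simp add: of_nat_diff field_simps)
  finally show "(\<Sum>k=1..n. y k) = 2 + (real s - real a - 1) / (real a * real d)" .
qed

text \<open>Three disjoint sets of variables carry the weight claimed. The first \<open>a\<close> variables form a cover
  (\<open>p = 1\<close>). So do the next \<open>a d\<close> (\<open>p = a + 1\<close>), and among these the \<open>s - 1 - a\<close> heaviest,
  forming \<open>U\<close>, carry at least the average share \<open>(s - 1 - a) / (a d)\<close>; this many exist because
  \<open>s - 1 \<le> i (a + 1)\<close>. Deleting both the first \<open>a\<close> variables and \<open>U\<close> from \<open>{1..i s}\<close> removes only \<open>s - 1\<close>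
  elements, so what is left is a cover (\<open>p = s\<close>).\<close>

lemma borel_cover_weighting_lower:
  fixes i :: "nat \<Rightarrow> nat" and a d s n :: nat
  assumes i: "strict_mono_on {1..s} i" and i1: "\<And>p. p \<in> {1..s} \<Longrightarrow> i p \<in> {1..n}"
    and a: "0 < a" "a < s" and d: "0 < d"
    and i_first: "i 1 = a" and i_mid: "i (a + 1) = a + a * d" and s: "s - 1 \<le> i (a + 1)"
    and y: "y \<in> cover_weightings n (borel_generators (variable_product (i ` {1..s})))"
  shows "2 + (real s - real a - 1) / (real a * real d) \<le> (\<Sum>k=1..n. y k)"
proof -
  have cover: "1 \<le> (\<Sum>k\<in>C. y k)"
    if "C \<subseteq> {1..i p}" "p \<in> {1..s}" "card ({1..i p} - C) < p" for C p
  proof -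
    have "C \<subseteq> {1..n}" using that(1) i1[OF that(2)] by auto
    then have "cover n (borel_generators (variable_product (i ` {1..s}))) C"
      using cover_borel_iff[OF i] i1 that(2,3) by blast
    then show ?thesis using y by (simp add: cover_weightings_def)
  qed
  define T where "T = {a+1..i (a + 1)}"
  have T: "finite T" "card T = a * d" using i_mid by (simp_all add: T_def)
  have "{1..i (a+1)} - T = {1..a}" using i_mid by (auto simp: T_def)
  then have yT: "1 \<le> sum y T" using a by (intro cover[of _ "a + 1"]) (auto simp: T_def)
  have "s - 1 - a \<le> card T" using T s i_mid by simp
  then obtain U where U: "U \<subseteq> T" "card U = s - 1 - a"
    "real (s - 1 - a) * sum y T \<le> real (card T) * sum y U"
    using heavy_subset[OF T(1), of "s - 1 - a" y] by blast
  have finU: "finite U" using U(1) T(1) finite_subset by blast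
  have "real (s - 1 - a) \<le> real (s - 1 - a) * sum y T" using yT by (simp add: mult_le_cancel_left1)
  then have "real (s - 1 - a) \<le> real (a * d) * sum y U"
    using U(3)[unfolded T(2)] by (rule order_trans)
  then have yU: "(real s - real a - 1) / (real a * real d) \<le> sum y U"
    using a d by (simp add: field_simps of_nat_diff)
  have "{1..i 1} - {1..a} = {}" using i_first by simp
  then have y1: "1 \<le> sum y {1..a}" using i_first a by (intro cover[of _ 1]) auto
  define R where "R = {1..i s} - ({1..a} \<union> U)"
  have "card ({1..i s} - R) \<le> card ({1..a} \<union> U)"
    using finU by (intro card_mono) (auto simp: R_def)
  also have "\<dots> \<le> a + (s - 1 - a)" using card_Un_le[of "{1..a}" U] U(2) by simp
  finally have yR: "1 \<le> sum y R" using a by (intro cover[of _ s]) (auto simp: R_def)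
  have "i (a + 1) \<le> i s" using strict_mono_on_leD[OF i, of "a + 1" s] a by auto
  then have T_sub: "T \<subseteq> {1..n}" using i1[of s] a by (auto simp: T_def)
  have sub: "{1..a} \<union> U \<union> R \<subseteq> {1..n}"
    using T_sub U(1) i1[of s] i1[of 1] a i_first by (auto simp: R_def)
  have "sum y {1..a} + sum y U + sum y R = sum y ({1..a} \<union> U \<union> R)"
  proof -
    have "{1..a} \<inter> U = {}" using U(1) by (auto simp: T_def)
    then have "sum y ({1..a} \<union> U) = sum y {1..a} + sum y U" using finU by (intro sum.union_disjoint) auto
    moreover have "sum y ({1..a} \<union> U \<union> R) = sum y ({1..a} \<union> U) + sum y R"
      using finU by (intro sum.union_disjoint) (auto simp: R_def)
    ultimately show ?thesis by simp
  qed
  also have "\<dots> \<le> (\<Sum>k=1..n. y k)"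
    using sub y by (intro sum_mono2) (auto simp: cover_weightings_def)
  finally show ?thesis using y1 yU yR by linarith
qed

theorem theorem4p1:
  fixes n s :: nat and i :: "nat \<Rightarrow> nat" and m :: monomial
    and I :: "'k::field mpolynomial set"
  assumes "strict_mono_on {1..s} i"
    and "i s \<le> n"
    and "2 \<le> i 1" and "i 1 \<le> s - 1"
    and "m = (\<Sum>j = 1..s. Poly_Mapping.single (i j) 1)"
    and "I = sfBorel n m"
    and "\<And>j. 3 \<le> j \<Longrightarrow> j \<le> i 1 + 1 \<Longrightarrow> i j - i 1 \<ge> (j - 1) * (i 2 - i 1)"
  shows "waldschmidt n I \<le>
           2 + (real s - real (i 1) - 1) / (real (i 1) * (real (i 2) - real (i 1))) \<and>
         (i (i 1 + 1) \<ge> s - 1 \<and> i 1 * (i 2 - i 1) = i (i 1 + 1) - i 1 \<longrightarrow>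
           waldschmidt n I =
             2 + (real s - real (i 1) - 1) / (real (i 1) * (real (i 2) - real (i 1))))"
proof -
  note i = assms(1)
  define a where "a = i 1"
  define d where "d = i 2 - i 1"
  let ?G = "borel_generators m"
  let ?v = "2 + (real s - real a - 1) / (real a * real d)"
  have a: "0 < a" "a < s" and "3 \<le> s" using assms(3,4) by (auto simp: a_def)
  have "i 1 < i 2" using strict_mono_onD[OF i, of 1 2] \<open>3 \<le> s\<close> by auto
  then have d: "0 < d" "real (i 2) - real (i 1) = real d" by (simp_all add: d_def of_nat_diff)
  have mono: "i p \<le> i q" if "1 \<le> p" "p \<le> q" "q \<le> s" for p q
    using strict_mono_on_leD[OF i, of p q] that by auto
  have i1: "i p \<in> {1..n}" if "p \<in> {1..s}" for p
    using mono[of 1 p] mono[of p s] that assms(2,3) by auto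
  have inj: "inj_on i {1..s}" using i by (rule strict_mono_on_imp_inj_on)
  have m: "m = variable_product (i ` {1..s})"
    using inj by (simp add: assms(5) variable_product_def sum.reindex)
  have gap: "a + (p - 1) * d \<le> i p" if p: "p \<in> {1..a+1}" for p
  proof -
    consider "p = 1" | "p = 2" | "3 \<le> p" using p by fastforce
    then show ?thesis
    proof cases
      case 2
      then show ?thesis using \<open>i 1 < i 2\<close> by (simp add: a_def d_def)
    next
      case 3
      then have "(p - 1) * d \<le> i p - a" using assms(7)[of p] p by (simp add: a_def d_def)
      moreover have "a \<le> i p" using mono[of 1 p] p a by (auto simp: a_def)
      ultimately show ?thesis by simp
    qed (simp add: a_def)
  qed
  have m_mon: "m \<in> monomials n" using i1 by (auto simp: m monomials_def keys_variable_product)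
  have "borel_move m m" unfolding m using inj i1 by (intro borel_move_injection) auto
  then have ne: "?G \<noteq> {}"
    using squarefree_variable_product[of "i ` {1..s}"] by (auto simp: borel_generators_def m)
  have G: "?G \<subseteq> monomials n"
    using borel_move_monomials[OF m_mon] by (auto simp: borel_generators_def)
  have sf: "\<And>g. g \<in> ?G \<Longrightarrow> squarefree_monomial g" by (simp add: borel_generators_def)
  have I: "I = Idl\<^bsub>poly_ring n\<^esub> (monomial_poly ` ?G)"
    using assms(6) by (simp add: sfBorel_def borel_generators_def)
  note upper = borel_cover_weighting[OF i i1 a d(1) gap, folded m]
  have le: "waldschmidt n I \<le> ?v"
    unfolding I using waldschmidt_le[OF G sf ne upper(1), where 'k = 'k] by (simp only: upper(2))
  have "?v \<le> waldschmidt n I" if eq: "s - 1 \<le> i (i 1 + 1)" "i 1 * (i 2 - i 1) = i (i 1 + 1) - i 1"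
    unfolding I
  proof (rule le_waldschmidt[OF G sf ne])
    show "cover_weightings n ?G \<noteq> {}" using upper(1) by blast
    have mid: "i (a + 1) = a + a * d"
      using eq(2) mono[of 1 "a + 1"] a by (simp add: a_def d_def)
    show "?v \<le> (\<Sum>k=1..n. y k)" if "y \<in> cover_weightings n ?G" for y
      using that eq(1) by (intro borel_cover_weighting_lower[OF i i1 a d(1) _ mid])
        (simp_all add: a_def m)
  qed
  then show ?thesis using le d(2) by (auto simp: a_def)
qed

end
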